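(* Let $(M,\varphi_\alpha,\eta^\alpha,\xi_\alpha,g)$, $\alpha=1,2,3$, be a $3$-Sasakian manifold of dimension $4n+3$ with Levi-Civita connection $\nabla$, and let $\bar\nabla$ be the linear connection on $M$ defined by $$\bar{\nabla}_XY=\nabla_XY-\sum_{\alpha=1}^3\eta^{\alpha}(X)\nabla_Y\xi_{\alpha}-\sum_{\alpha=1}^3\eta^{\alpha}(Y)\nabla_X\xi_{\alpha}+\sum_{\alpha=1}^3\Omega^{\alpha}(X,Y)\xi_{\alpha}.$$ Then, with respect to the adapted local basis $\{\xi_1,\xi_2,\xi_3,\frac{\delta}{\delta x^1},\dots,\frac{\delta}{\delta x^{4n}}\}$, the linear connection $\bar\nabla$ is completely determined by $$\bar{\nabla}_{\frac{\delta}{\delta x^i}}\frac{\delta}{\delta x^j}=\sum_k F_{ij}^k\frac{\delta}{\delta x^k},\qquad \bar{\nabla}_{\xi_{\alpha}}\frac{\delta}{\delta x^i}=\bar{\nabla}_{\frac{\delta}{\delta x^i}}\xi_{\alpha}=0,\qquad \bar{\nabla}_{\xi_{\alpha}}\xi_{\beta}=0,$$ where $$F_{ij}^k=\sum_h\frac{g^{kh}}{2}\left\{\frac{\delta g_{ih}}{\delta x^j}+\frac{\delta g_{jh}}{\delta x^i}-\frac{\delta g_{ij}}{\delta x^h}\right\}.$$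
   Context: A Sasakian structure on a Riemannian manifold $(M,g)$ consists of a $(1,1)$-tensor $\varphi$, a vector field $\xi$ and a $1$-form $\eta$ with $\varphi^2=-I+\eta\otimes\xi$, $\eta(\xi)=1$, $\eta(X)=g(\xi,X)$, $g(\varphi X,\varphi Y)=g(X,Y)-\eta(X)\eta(Y)$ and $(\nabla_X\varphi)Y=g(X,Y)\xi-\eta(Y)X$, where $\nabla$ is the Levi-Civita connection of $g$. A $3$-Sasakian manifold is a smooth Riemannian manifold $(M,g)$ of dimension $4n+3$ with three Sasakian structures $(\varphi_\alpha,\eta^\alpha,\xi_\alpha,g)$, $\alpha=1,2,3$, such that for all even permutations $(\beta,\gamma,\theta)$ of $(1,2,3)$: $\varphi_\theta=\varphi_\beta\varphi_\gamma-\eta^\gamma\otimes\xi_\beta=-\varphi_\gamma\varphi_\beta+\eta^\beta\otimes\xi_\gamma$, $\xi_\theta=\varphi_\beta\xi_\gamma=-\varphi_\gamma\xi_\beta$, $\eta^\theta=\eta^\beta\circ\varphi_\gamma=-\eta^\gamma\circ\varphi_\beta$. Put $\Omega^\alpha(X,Y)=g(X,\varphi_\alpha Y)$. The distribution spanned by $\xi_1,\xi_2,\xi_3$ is integrable and defines a $3$-dimensional foliation on $M$. Adapted local basis: considering this foliation, choose a local coordinate system $(z^1,z^2,z^3,x^1,\dots,x^{4n})$ on $M$ in which $\xi_\alpha=\frac{\partial}{\partial z^\alpha}$ for $\alpha=1,2,3$, and set $\frac{\delta}{\delta x^i}=\frac{\partial}{\partial x^i}-\sum_\alpha\eta_i^\alpha\xi_\alpha$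 with $\eta_i^\alpha=\eta^\alpha\left(\frac{\partial}{\partial x^i}\right)$. The $\frac{\delta}{\delta x^i}$ form a local basis of $\mathbf H=\bigcap_{\alpha=1}^3\ker\eta^\alpha$, the distribution $g$-orthogonal to the foliation. Put $g_{ij}=g\left(\frac{\delta}{\delta x^i},\frac{\delta}{\delta x^j}\right)$, with $(g^{ij})$ the inverse matrix of $(g_{ij})$; $\frac{\delta f}{\delta x^i}$ denotes the derivative of the function $f$ along the vector field $\frac{\delta}{\delta x^i}$. Indices $i,j,k,h$ range over $1,\dots,4n$ and $\alpha,\beta$ over $1,2,3$.
   Formalization: Coordinates with ξ_α = ∂/∂z^α cannot exist, since [ξ_1,ξ_2] = 2ξ_3 ≠ 0; instead the chart is only required to be adapted to the foliation, i.e. ∂/∂z^1, ∂/∂z^2, ∂/∂z^3 span the same distribution as ξ_1, ξ_2, ξ_3. *)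

theory Defs
  imports "HOL-Analysis.Analysis"
begin

section \<open>Smooth manifolds\<close>

primrec Ck_on :: "nat \<Rightarrow> 'v::real_normed_vector set \<Rightarrow> ('v \<Rightarrow> 'w::real_normed_vector) \<Rightarrow> bool" where
  "Ck_on 0 S f \<longleftrightarrow> continuous_on S f"
| "Ck_on (Suc k) S f \<longleftrightarrow>
     (\<forall>x\<in>S. f differentiable (at x)) \<and> (\<forall>v. Ck_on k S (\<lambda>x. frechet_derivative f (at x) v))"

text \<open>Only meaningful for open \<open>S\<close>, since derivatives are taken in full neighbourhoods.\<close>

definition smooth_on :: "'v::real_normed_vector set \<Rightarrow> ('v \<Rightarrow> 'w::real_normed_vector) \<Rightarrow> bool" where
  "smooth_on S f \<longleftrightarrow> (\<forall>k. Ck_on k S f)"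

text \<open>A chart is a pair of an open domain and a total function of which only the values on
  the domain matter. The points of the manifold are all elements of the type \<open>'a\<close>;
  the dimension is the number of elements of the index type \<open>'m\<close>.\<close>

type_synonym ('a, 'm) chart = "'a set \<times> ('a \<Rightarrow> real ^ 'm)"

definition is_chart :: "('a::topological_space, 'm::finite) chart \<Rightarrow> bool" where
  "is_chart c \<longleftrightarrow> (case c of (U, \<psi>) \<Rightarrow>
     open U \<and> open (\<psi> ` U) \<and> homeomorphism U (\<psi> ` U) \<psi> (inv_into U \<psi>))"

definition compatible :: "('a, 'm::finite) chart \<Rightarrow> ('a, 'm) chart \<Rightarrow> bool" where
  "compatible c d \<longleftrightarrow> (case (c, d) of ((U, \<psi>), (V, \<rho>)) \<Rightarrow>
     smooth_on (\<psi> ` (U \<inter> V)) (\<rho> \<circ> inv_into U \<psi>) \<and>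
     smooth_on (\<rho> ` (U \<inter> V)) (\<psi> \<circ> inv_into V \<rho>))"

text \<open>A smooth structure is a maximal smooth atlas.\<close>

definition smooth_manifold ::
  "('a::{t2_space, second_countable_topology}, 'm::finite) chart set \<Rightarrow> bool" where
  "smooth_manifold A \<longleftrightarrow>
     (\<forall>c\<in>A. is_chart c) \<and> (\<Union>c\<in>A. fst c) = UNIV \<and>
     (\<forall>c\<in>A. \<forall>d\<in>A. compatible c d) \<and>
     (\<forall>c. is_chart c \<and> (\<forall>d\<in>A. compatible c d) \<longrightarrow> c \<in> A)"

definition smooth_fun_on ::
  "('a::topological_space, 'm::finite) chart set \<Rightarrow> 'a set \<Rightarrow> ('a \<Rightarrow> real) \<Rightarrow> bool" where
  "smooth_fun_on A W f \<longleftrightarrow>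
     open W \<and> (\<forall>(U, \<psi>)\<in>A. smooth_on (\<psi> ` (U \<inter> W)) (f \<circ> inv_into U \<psi>))"

definition smooth_near ::
  "('a::topological_space, 'm::finite) chart set \<Rightarrow> 'a \<Rightarrow> ('a \<Rightarrow> real) \<Rightarrow> bool" where
  "smooth_near A p f \<longleftrightarrow> (\<exists>W. p \<in> W \<and> smooth_fun_on A W f)"


section \<open>Tangent vectors and vector fields\<close>

text \<open>A tangent vector at \<open>p\<close> acts by directional differentiation on the functions that are
  smooth near \<open>p\<close>. It is made a total functional by the value \<open>0\<close> on all other
  functions. The type of all functionals is the ambient vector space of the tangent spaces.\<close>

typedef 'a tvec = "UNIV :: (('a \<Rightarrow> real) \<Rightarrow> real) set"
  morphisms dapp Tvec
  by simp

setup_lifting type_definition_tvec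

instantiation tvec :: (type) real_vector
begin

lift_definition zero_tvec :: "'a tvec" is "\<lambda>f. 0" .
lift_definition plus_tvec :: "'a tvec \<Rightarrow> 'a tvec \<Rightarrow> 'a tvec" is "\<lambda>v w f. v f + w f" .
lift_definition minus_tvec :: "'a tvec \<Rightarrow> 'a tvec \<Rightarrow> 'a tvec" is "\<lambda>v w f. v f - w f" .
lift_definition uminus_tvec :: "'a tvec \<Rightarrow> 'a tvec" is "\<lambda>v f. - v f" .
lift_definition scaleR_tvec :: "real \<Rightarrow> 'a tvec \<Rightarrow> 'a tvec" is "\<lambda>r v f. r * v f" .

instance
  by standard (transfer; simp add: fun_eq_iff algebra_simps)+

end

definition chart_vec ::
  "('a::topological_space, 'm::finite) chart set \<Rightarrow> ('a, 'm) chart \<Rightarrow> real ^ 'm \<Rightarrow> 'a \<Rightarrow> 'a tvec" where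
  "chart_vec A c a p = Tvec (\<lambda>f.
     if smooth_near A p f
     then frechet_derivative (f \<circ> inv_into (fst c) (snd c)) (at (snd c p)) a
     else 0)"

definition tangent_space ::
  "('a::topological_space, 'm::finite) chart set \<Rightarrow> 'a \<Rightarrow> 'a tvec set" where
  "tangent_space A p = {chart_vec A c a p | c a. c \<in> A \<and> p \<in> fst c}"

definition coord_field ::
  "('a::topological_space, 'm::finite) chart set \<Rightarrow> ('a, 'm) chart \<Rightarrow> 'm \<Rightarrow> 'a \<Rightarrow> 'a tvec" where
  "coord_field A c m p = chart_vec A c (axis m 1) p"

text \<open>Smooth vector fields on an open set \<open>W\<close>; the values outside \<open>W\<close> are irrelevant.\<close>

definition vector_field_on ::
  "('a::topological_space, 'm::finite) chart set \<Rightarrow> 'a set \<Rightarrow> ('a \<Rightarrow> 'a tvec) \<Rightarrow> bool" where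
  "vector_field_on A W X \<longleftrightarrow>
     open W \<and> (\<forall>p\<in>W. X p \<in> tangent_space A p) \<and>
     (\<forall>V f. V \<subseteq> W \<and> smooth_fun_on A V f \<longrightarrow> smooth_fun_on A V (\<lambda>p. dapp (X p) f))"

definition lie_bracket ::
  "('a::topological_space, 'm::finite) chart set \<Rightarrow>
     ('a \<Rightarrow> 'a tvec) \<Rightarrow> ('a \<Rightarrow> 'a tvec) \<Rightarrow> 'a \<Rightarrow> 'a tvec" where
  "lie_bracket A X Y p = Tvec (\<lambda>f.
     if smooth_near A p f
     then dapp (X p) (\<lambda>q. dapp (Y q) f) - dapp (Y p) (\<lambda>q. dapp (X q) f)
     else 0)"


section \<open>Tensor fields, metrics and connections\<close>

definition one_form ::
  "('a::topological_space, 'm::finite) chart set \<Rightarrow> ('a \<Rightarrow> 'a tvec \<Rightarrow> real) \<Rightarrow> bool" where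
  "one_form A \<omega> \<longleftrightarrow>
     (\<forall>p. \<forall>v\<in>tangent_space A p. \<forall>w\<in>tangent_space A p. \<forall>a b.
        \<omega> p (a *\<^sub>R v + b *\<^sub>R w) = a * \<omega> p v + b * \<omega> p w) \<and>
     (\<forall>W X. vector_field_on A W X \<longrightarrow> smooth_fun_on A W (\<lambda>p. \<omega> p (X p)))"

definition tensor11 ::
  "('a::topological_space, 'm::finite) chart set \<Rightarrow> ('a \<Rightarrow> 'a tvec \<Rightarrow> 'a tvec) \<Rightarrow> bool" where
  "tensor11 A T \<longleftrightarrow>
     (\<forall>p. \<forall>v\<in>tangent_space A p. T p v \<in> tangent_space A p) \<and>
     (\<forall>p. \<forall>v\<in>tangent_space A p. \<forall>w\<in>tangent_space A p. \<forall>a b.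
        T p (a *\<^sub>R v + b *\<^sub>R w) = a *\<^sub>R T p v + b *\<^sub>R T p w) \<and>
     (\<forall>W X. vector_field_on A W X \<longrightarrow> vector_field_on A W (\<lambda>p. T p (X p)))"

definition riemannian_metric ::
  "('a::topological_space, 'm::finite) chart set \<Rightarrow> ('a \<Rightarrow> 'a tvec \<Rightarrow> 'a tvec \<Rightarrow> real) \<Rightarrow> bool" where
  "riemannian_metric A g \<longleftrightarrow>
     (\<forall>p. \<forall>u\<in>tangent_space A p. \<forall>v\<in>tangent_space A p. \<forall>w\<in>tangent_space A p. \<forall>a b.
        g p (a *\<^sub>R u + b *\<^sub>R v) w = a * g p u w + b * g p v w) \<and>
     (\<forall>p. \<forall>v\<in>tangent_space A p. \<forall>w\<in>tangent_space A p. g p v w = g p w v) \<and>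
     (\<forall>p. \<forall>v\<in>tangent_space A p. v \<noteq> 0 \<longrightarrow> g p v v > 0) \<and>
     (\<forall>W X Y. vector_field_on A W X \<and> vector_field_on A W Y \<longrightarrow>
        smooth_fun_on A W (\<lambda>p. g p (X p) (Y p)))"

text \<open>A linear connection on the open submanifold \<open>U\<close>, acting on vector fields defined on open
  subsets \<open>W\<close> of \<open>U\<close>. Since \<open>W\<close> varies and the fields are total functions,
  compatibility with restriction is part of the axioms: if \<open>X\<close> and \<open>X'\<close> agree on \<open>W\<close>,
  then \<open>X - X' = f (X - X')\<close> for the indicator function \<open>f\<close> of the complement of \<open>W\<close>,
  and \<open>f\<close> is smooth on \<open>W\<close> because it vanishes there.\<close>

definition linear_connection_on ::
  "('a::topological_space, 'm::finite) chart set \<Rightarrow> 'a set \<Rightarrow>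
     (('a \<Rightarrow> 'a tvec) \<Rightarrow> ('a \<Rightarrow> 'a tvec) \<Rightarrow> 'a \<Rightarrow> 'a tvec) \<Rightarrow> bool" where
  "linear_connection_on A U D \<longleftrightarrow>
     open U \<and>
     (\<forall>W X Y. W \<subseteq> U \<and> vector_field_on A W X \<and> vector_field_on A W Y \<longrightarrow>
        vector_field_on A W (D X Y) \<and>
        (\<forall>Z. vector_field_on A W Z \<longrightarrow>
           (\<forall>p\<in>W. D (\<lambda>q. X q + Z q) Y p = D X Y p + D Z Y p) \<and>
           (\<forall>p\<in>W. D X (\<lambda>q. Y q + Z q) p = D X Y p + D X Z p)) \<and>
        (\<forall>f. smooth_fun_on A W f \<longrightarrow>
           (\<forall>p\<in>W. D (\<lambda>q. f q *\<^sub>R X q) Y p = f p *\<^sub>R D X Y p) \<and>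
           (\<forall>p\<in>W. D X (\<lambda>q. f q *\<^sub>R Y q) p = f p *\<^sub>R D X Y p + dapp (X p) f *\<^sub>R Y p)))"

definition levi_civita ::
  "('a::topological_space, 'm::finite) chart set \<Rightarrow> ('a \<Rightarrow> 'a tvec \<Rightarrow> 'a tvec \<Rightarrow> real) \<Rightarrow>
     (('a \<Rightarrow> 'a tvec) \<Rightarrow> ('a \<Rightarrow> 'a tvec) \<Rightarrow> 'a \<Rightarrow> 'a tvec) \<Rightarrow> bool" where
  "levi_civita A g D \<longleftrightarrow>
     linear_connection_on A UNIV D \<and>
     (\<forall>W X Y. vector_field_on A W X \<and> vector_field_on A W Y \<longrightarrow>
        (\<forall>p\<in>W. D X Y p - D Y X p = lie_bracket A X Y p)) \<and>
     (\<forall>W X Y Z. vector_field_on A W X \<and> vector_field_on A W Y \<and> vector_field_on A W Z \<longrightarrow>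
        (\<forall>p\<in>W. dapp (X p) (\<lambda>q. g q (Y q) (Z q)) = g p (D X Y p) (Z p) + g p (Y p) (D X Z p)))"


section \<open>3-Sasakian manifolds\<close>

definition sasakian_structure ::
  "('a::topological_space, 'm::finite) chart set \<Rightarrow> ('a \<Rightarrow> 'a tvec \<Rightarrow> 'a tvec \<Rightarrow> real) \<Rightarrow>
     (('a \<Rightarrow> 'a tvec) \<Rightarrow> ('a \<Rightarrow> 'a tvec) \<Rightarrow> 'a \<Rightarrow> 'a tvec) \<Rightarrow>
     ('a \<Rightarrow> 'a tvec \<Rightarrow> 'a tvec) \<Rightarrow> ('a \<Rightarrow> 'a tvec) \<Rightarrow> ('a \<Rightarrow> 'a tvec \<Rightarrow> real) \<Rightarrow> bool" where
  "sasakian_structure A g D \<phi> \<xi> \<eta> \<longleftrightarrow>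
     tensor11 A \<phi> \<and> vector_field_on A UNIV \<xi> \<and> one_form A \<eta> \<and>
     (\<forall>p. \<forall>v\<in>tangent_space A p. \<phi> p (\<phi> p v) = - v + \<eta> p v *\<^sub>R \<xi> p) \<and>
     (\<forall>p. \<eta> p (\<xi> p) = 1) \<and>
     (\<forall>p. \<forall>v\<in>tangent_space A p. \<eta> p v = g p (\<xi> p) v) \<and>
     (\<forall>p. \<forall>v\<in>tangent_space A p. \<forall>w\<in>tangent_space A p.
        g p (\<phi> p v) (\<phi> p w) = g p v w - \<eta> p v * \<eta> p w) \<and>
     (\<forall>W X Y. vector_field_on A W X \<and> vector_field_on A W Y \<longrightarrow>
        (\<forall>p\<in>W. D X (\<lambda>q. \<phi> q (Y q)) p - \<phi> p (D X Y p)
                = g p (X p) (Y p) *\<^sub>R \<xi> p - \<eta> p (Y p) *\<^sub>R X p))"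

text \<open>The three structures are indexed by the type \<open>3\<close>, in which \<open>3 = 0\<close>, so that
  \<open>1\<close>, \<open>2\<close>, \<open>3\<close> are exactly its three elements.\<close>

definition three_sasakian ::
  "nat \<Rightarrow> ('a::{t2_space, second_countable_topology}, 'm::finite) chart set \<Rightarrow>
     ('a \<Rightarrow> 'a tvec \<Rightarrow> 'a tvec \<Rightarrow> real) \<Rightarrow>
     (('a \<Rightarrow> 'a tvec) \<Rightarrow> ('a \<Rightarrow> 'a tvec) \<Rightarrow> 'a \<Rightarrow> 'a tvec) \<Rightarrow>
     (3 \<Rightarrow> 'a \<Rightarrow> 'a tvec \<Rightarrow> 'a tvec) \<Rightarrow> (3 \<Rightarrow> 'a \<Rightarrow> 'a tvec) \<Rightarrow>
     (3 \<Rightarrow> 'a \<Rightarrow> 'a tvec \<Rightarrow> real) \<Rightarrow> bool" where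
  "three_sasakian n A g D \<phi> \<xi> \<eta> \<longleftrightarrow>
     smooth_manifold A \<and> CARD('m) = 4 * n + 3 \<and> riemannian_metric A g \<and> levi_civita A g D \<and>
     (\<forall>\<alpha>. sasakian_structure A g D (\<phi> \<alpha>) (\<xi> \<alpha>) (\<eta> \<alpha>)) \<and>
     (\<forall>(\<beta>, \<gamma>, \<theta>) \<in> {(1, 2, 3), (2, 3, 1), (3, 1, 2)}. \<forall>p.
        (\<forall>v\<in>tangent_space A p.
           \<phi> \<theta> p v = \<phi> \<beta> p (\<phi> \<gamma> p v) - \<eta> \<gamma> p v *\<^sub>R \<xi> \<beta> p \<and>
           \<phi> \<theta> p v = - \<phi> \<gamma> p (\<phi> \<beta> p v) + \<eta> \<beta> p v *\<^sub>R \<xi> \<gamma> p \<and>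
           \<eta> \<theta> p v = \<eta> \<beta> p (\<phi> \<gamma> p v) \<and>
           \<eta> \<theta> p v = - \<eta> \<gamma> p (\<phi> \<beta> p v)) \<and>
        \<xi> \<theta> p = \<phi> \<beta> p (\<xi> \<gamma> p) \<and>
        \<xi> \<theta> p = - \<phi> \<gamma> p (\<xi> \<beta> p))"

definition fundamental_form ::
  "('a \<Rightarrow> 'a tvec \<Rightarrow> 'a tvec \<Rightarrow> real) \<Rightarrow> (3 \<Rightarrow> 'a \<Rightarrow> 'a tvec \<Rightarrow> 'a tvec) \<Rightarrow>
     3 \<Rightarrow> 'a \<Rightarrow> 'a tvec \<Rightarrow> 'a tvec \<Rightarrow> real" where
  "fundamental_form g \<phi> \<alpha> p v w = g p v (\<phi> \<alpha> p w)"

definition bar_connection ::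
  "('a \<Rightarrow> 'a tvec \<Rightarrow> 'a tvec \<Rightarrow> real) \<Rightarrow>
     (('a \<Rightarrow> 'a tvec) \<Rightarrow> ('a \<Rightarrow> 'a tvec) \<Rightarrow> 'a \<Rightarrow> 'a tvec) \<Rightarrow>
     (3 \<Rightarrow> 'a \<Rightarrow> 'a tvec \<Rightarrow> 'a tvec) \<Rightarrow> (3 \<Rightarrow> 'a \<Rightarrow> 'a tvec) \<Rightarrow>
     (3 \<Rightarrow> 'a \<Rightarrow> 'a tvec \<Rightarrow> real) \<Rightarrow>
     ('a \<Rightarrow> 'a tvec) \<Rightarrow> ('a \<Rightarrow> 'a tvec) \<Rightarrow> 'a \<Rightarrow> 'a tvec" where
  "bar_connection g D \<phi> \<xi> \<eta> X Y p =
     D X Y p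
     - (\<Sum>\<alpha>\<in>UNIV. \<eta> \<alpha> p (X p) *\<^sub>R D Y (\<xi> \<alpha>) p)
     - (\<Sum>\<alpha>\<in>UNIV. \<eta> \<alpha> p (Y p) *\<^sub>R D X (\<xi> \<alpha>) p)
     + (\<Sum>\<alpha>\<in>UNIV. fundamental_form g \<phi> \<alpha> p (X p) (Y p) *\<^sub>R \<xi> \<alpha> p)"


section \<open>Adapted local bases\<close>

text \<open>A chart adapted to the foliation tangent to the three fields: the coordinates with
  indices \<open>z 1\<close>, \<open>z 2\<close>, \<open>z 3\<close> are \<open>z\<^sup>1\<close>, \<open>z\<^sup>2\<close>, \<open>z\<^sup>3\<close>, the remaining ones are the
  transversal coordinates \<open>x\<^sup>i\<close>, and \<open>\<partial>/\<partial>z\<^sup>\<alpha>\<close> span the tangent spaces of the leaves.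
  On a 3-Sasakian manifold \<open>[\<xi>\<^sub>1, \<xi>\<^sub>2] = 2 \<xi>\<^sub>3\<close>, so there is no chart with
  \<open>\<xi>\<^sub>\<alpha> = \<partial>/\<partial>z\<^sup>\<alpha>\<close> for all three \<open>\<alpha>\<close> at once, and that requirement would make every
  statement about such charts vacuous. It is a special case of the present one, see
  \<open>adapted_chartI\<close>.\<close>

definition adapted_chart ::
  "('a::topological_space, 'm::finite) chart set \<Rightarrow> (3 \<Rightarrow> 'a \<Rightarrow> 'a tvec) \<Rightarrow>
     ('a, 'm) chart \<Rightarrow> (3 \<Rightarrow> 'm) \<Rightarrow> bool" where
  "adapted_chart A \<xi> c z \<longleftrightarrow>
     c \<in> A \<and> inj z \<and>
     (\<forall>p\<in>fst c. span (range (\<lambda>\<alpha>. \<xi> \<alpha> p)) = span (range (\<lambda>\<alpha>. coord_field A c (z \<alpha>) p)))"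

lemma adapted_chartI:
  assumes "c \<in> A" "inj z" "\<And>\<alpha> p. p \<in> fst c \<Longrightarrow> \<xi> \<alpha> p = coord_field A c (z \<alpha>) p"
  shows "adapted_chart A \<xi> c z"
  using assms by (simp add: adapted_chart_def)

definition delta ::
  "('a::topological_space, 'm::finite) chart set \<Rightarrow> (3 \<Rightarrow> 'a \<Rightarrow> 'a tvec) \<Rightarrow>
     (3 \<Rightarrow> 'a \<Rightarrow> 'a tvec \<Rightarrow> real) \<Rightarrow> ('a, 'm) chart \<Rightarrow> 'm \<Rightarrow> 'a \<Rightarrow> 'a tvec" where
  "delta A \<xi> \<eta> c i p =
     coord_field A c i p - (\<Sum>\<alpha>\<in>UNIV. \<eta> \<alpha> p (coord_field A c i p) *\<^sub>R \<xi> \<alpha> p)"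

definition inverse_matrix_on :: "'i set \<Rightarrow> ('i \<Rightarrow> 'i \<Rightarrow> real) \<Rightarrow> 'i \<Rightarrow> 'i \<Rightarrow> real" where
  "inverse_matrix_on I G = (SOME B. \<forall>i\<in>I. \<forall>j\<in>I.
     (\<Sum>k\<in>I. B i k * G k j) = (if i = j then 1 else 0) \<and>
     (\<Sum>k\<in>I. G i k * B k j) = (if i = j then 1 else 0))"

definition transversal_metric ::
  "('a::topological_space, 'm::finite) chart set \<Rightarrow> ('a \<Rightarrow> 'a tvec \<Rightarrow> 'a tvec \<Rightarrow> real) \<Rightarrow>
     (3 \<Rightarrow> 'a \<Rightarrow> 'a tvec) \<Rightarrow> (3 \<Rightarrow> 'a \<Rightarrow> 'a tvec \<Rightarrow> real) \<Rightarrow> ('a, 'm) chart \<Rightarrow>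
     'm \<Rightarrow> 'm \<Rightarrow> 'a \<Rightarrow> real" where
  "transversal_metric A g \<xi> \<eta> c i j p = g p (delta A \<xi> \<eta> c i p) (delta A \<xi> \<eta> c j p)"

text \<open>The transversal coordinate indices \<open>1, \<dots>, 4n\<close> are the elements of \<open>- range z\<close>.\<close>

definition transversal_coeff ::
  "('a::topological_space, 'm::finite) chart set \<Rightarrow> ('a \<Rightarrow> 'a tvec \<Rightarrow> 'a tvec \<Rightarrow> real) \<Rightarrow>
     (3 \<Rightarrow> 'a \<Rightarrow> 'a tvec) \<Rightarrow> (3 \<Rightarrow> 'a \<Rightarrow> 'a tvec \<Rightarrow> real) \<Rightarrow> ('a, 'm) chart \<Rightarrow> (3 \<Rightarrow> 'm) \<Rightarrow>
     'm \<Rightarrow> 'm \<Rightarrow> 'm \<Rightarrow> 'a \<Rightarrow> real" where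
  "transversal_coeff A g \<xi> \<eta> c z k i j p =
     (let G = transversal_metric A g \<xi> \<eta> c; d = delta A \<xi> \<eta> c in
      \<Sum>h\<in>- range z. inverse_matrix_on (- range z) (\<lambda>a b. G a b p) k h / 2 *
        (dapp (d j p) (G i h) + dapp (d i p) (G j h) - dapp (d h p) (G i j)))"

definition adapted_equations ::
  "('a::topological_space, 'm::finite) chart set \<Rightarrow> ('a \<Rightarrow> 'a tvec \<Rightarrow> 'a tvec \<Rightarrow> real) \<Rightarrow>
     (3 \<Rightarrow> 'a \<Rightarrow> 'a tvec) \<Rightarrow> (3 \<Rightarrow> 'a \<Rightarrow> 'a tvec \<Rightarrow> real) \<Rightarrow> ('a, 'm) chart \<Rightarrow> (3 \<Rightarrow> 'm) \<Rightarrow>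
     (('a \<Rightarrow> 'a tvec) \<Rightarrow> ('a \<Rightarrow> 'a tvec) \<Rightarrow> 'a \<Rightarrow> 'a tvec) \<Rightarrow> bool" where
  "adapted_equations A g \<xi> \<eta> c z E \<longleftrightarrow>
     (let d = delta A \<xi> \<eta> c in
      \<forall>p\<in>fst c.
        (\<forall>i\<in>- range z. \<forall>j\<in>- range z.
           E (d i) (d j) p = (\<Sum>k\<in>- range z. transversal_coeff A g \<xi> \<eta> c z k i j p *\<^sub>R d k p)) \<and>
        (\<forall>\<alpha>. \<forall>i\<in>- range z. E (\<xi> \<alpha>) (d i) p = 0 \<and> E (d i) (\<xi> \<alpha>) p = 0) \<and>
        (\<forall>\<alpha> \<beta>. E (\<xi> \<alpha>) (\<xi> \<beta>) p = 0))"

end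

theory Submission
  imports Defs
begin

text \<open>
  A vector is vertical if it lies in the span of the three characteristic vectors \<open>\<xi> \<alpha>\<close>, and
  horizontal if the three contact forms \<open>\<eta> \<alpha>\<close> annihilate it. Since the \<open>\<xi> \<alpha>\<close> are orthonormal
  and \<open>\<eta> \<alpha>\<close> is dual to \<open>\<xi> \<alpha>\<close>, the two subspaces are orthogonal complements. The proof obtains
  almost every equation from the fact that a vector which is both vertical and horizontal is zero.

  The Sasakian identity for the derivative of the structure tensor, applied to \<open>\<xi> \<alpha>\<close>, gives
  \<open>D X (\<xi> \<alpha>) = - \<phi> \<alpha> X\<close> (\<open>nabla_xi\<close>), so the modified connection is the Levi-Civita connection plus
  a tensor that is algebraic in the structure (\<open>bar_via_phi\<close>). Hence it is a linear connection, and
  on two characteristic fields it is a combination of the products \<open>\<phi> \<alpha> (\<xi> \<beta>)\<close>, which cancels by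
  the quaternionic relations (\<open>cross_product_vertical\<close>).

  In an adapted chart, vertical vectors are exactly those on which all transversal coordinates
  have derivative zero (\<open>vertical_coordinate\<close>, \<open>verticalI\<close>). The derivatives of these coordinates
  along the fields \<open>\<xi> \<alpha>\<close> and \<open>\<delta> i\<close> are constant, so all brackets of these fields are vertical
  (\<open>torsion_vertical\<close>). The bracket of \<open>\<xi> \<alpha>\<close> and \<open>\<delta> i\<close> is also horizontal, so it vanishes; it is
  the only part of \<open>bar (\<xi> \<alpha>) (\<delta> i)\<close> that does not cancel directly. For \<open>\<delta> i\<close> and \<open>\<delta> j\<close>, the term with
  the fundamental forms removes exactly the vertical part of the Levi-Civita derivative, and the
  horizontal part is computed by Koszul's formula, in which the bracket terms are vertical and
  therefore orthogonal to every \<open>\<delta> h\<close> (\<open>koszul\<close>, \<open>bar_delta_delta\<close>).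

  The fields \<open>\<xi> \<alpha>\<close> and \<open>\<delta> i\<close> form a frame in which every vector field has smooth components
  (\<open>frame_expansion\<close>, \<open>frame_components\<close>), and a connection is determined by its values on a frame
  (\<open>connection_determined_by_frame\<close>). This gives uniqueness.

  Underneath lies the chain rule: it shows that smooth functions are closed under composition, that
  one chart yields the whole tangent space at a point, which is therefore a vector space, and that
  the coordinate fields of a chart are smooth in every other chart.
\<close>


section \<open>Calculus of smooth functions on open sets\<close>

lemma Ck_on_subset: "Ck_on k S f \<Longrightarrow> T \<subseteq> S \<Longrightarrow> Ck_on k T f"
  by (induction k arbitrary: f) (auto intro: continuous_on_subset)

lemma Ck_on_cong:
  assumes "open S" "\<And>x. x \<in> S \<Longrightarrow> f x = f' x" "Ck_on k S f"
  shows "Ck_on k S f'"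
  using assms(2,3)
proof (induction k arbitrary: f f')
  case 0
  then show ?case by (simp cong: continuous_on_cong)
next
  case (Suc k)
  have diff: "f differentiable (at x)" if "x \<in> S" for x
    using Suc.prems that by simp
  have eq: "frechet_derivative f (at x) = frechet_derivative f' (at x)" if "x \<in> S" for x
    using frechet_derivative_transform_within_open[OF diff[OF that] \<open>open S\<close> that] Suc.prems(1)
    by blast
  have "f' differentiable (at x)" if "x \<in> S" for x
    using has_derivative_transform_within_open[OF diff[OF that, unfolded frechet_derivative_works] \<open>open S\<close> that]
      Suc.prems(1) by (auto simp: differentiable_def)
  moreover have "Ck_on k S (\<lambda>x. frechet_derivative f' (at x) v)" for v
    by (rule Suc.IH[of "\<lambda>x. frechet_derivative f (at x) v"]) (use Suc.prems eq in auto)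
  ultimately show ?case by simp
qed

lemma Ck_on_SucD: "Ck_on (Suc k) S f \<Longrightarrow> Ck_on k S f"
proof (induction k arbitrary: f)
  case 0
  then show ?case
    by (auto intro!: continuous_at_imp_continuous_on differentiable_imp_continuous_within)
qed (use Ck_on.simps(2) in blast)

text \<open>It suffices to know the derivative at the points of \<open>S\<close>, because \<open>S\<close> is open. The closure
  properties below follow by induction on \<open>k\<close>, with a differentiation rule as second premise.\<close>

lemma Ck_on_SucI:
  assumes "open S" "\<And>x. x \<in> S \<Longrightarrow> (f has_derivative f' x) (at x)"
    and "\<And>v. Ck_on k S (\<lambda>x. f' x v)"
  shows "Ck_on (Suc k) S f"
  using assms frechet_derivative_at[OF assms(2)]
  by (auto simp: differentiable_def intro!: Ck_on_cong[OF assms(1) _ assms(3)])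

lemma Ck_on_has_derivative:
  "Ck_on (Suc k) S f \<Longrightarrow> x \<in> S \<Longrightarrow> (f has_derivative frechet_derivative f (at x)) (at x)"
  using frechet_derivative_works by auto

lemma Ck_on_const: "open S \<Longrightarrow> Ck_on k S (\<lambda>x. c)"
  by (induction k arbitrary: c) (auto intro!: Ck_on_SucI derivative_eq_intros simp del: Ck_on.simps(2))

lemma Ck_on_add:
  assumes "open S"
  shows "Ck_on k S f \<Longrightarrow> Ck_on k S h \<Longrightarrow> Ck_on k S (\<lambda>x. f x + h x)"
proof (induction k arbitrary: f h)
  case (Suc k)
  show ?case
    by (rule Ck_on_SucI[OF assms has_derivative_add[OF Ck_on_has_derivative Ck_on_has_derivative]])
      (use Suc in auto)
qed (auto intro: continuous_intros)

lemma Ck_on_linear: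
  assumes "open S" "bounded_linear L"
  shows "Ck_on k S f \<Longrightarrow> Ck_on k S (\<lambda>x. L (f x))"
proof (induction k arbitrary: f)
  case 0
  then show ?case
    using assms(2) by (auto intro: bounded_linear.continuous_on)
next
  case (Suc k)
  show ?case
    by (rule Ck_on_SucI[OF assms(1) bounded_linear.has_derivative[OF assms(2) Ck_on_has_derivative]])
      (use Suc in auto)
qed

lemma Ck_on_mult:
  fixes f h :: "'v::real_normed_vector \<Rightarrow> real"
  assumes "open S"
  shows "Ck_on k S f \<Longrightarrow> Ck_on k S h \<Longrightarrow> Ck_on k S (\<lambda>x. f x * h x)"
proof (induction k arbitrary: f h)
  case (Suc k)
  show ?case
  proof (rule Ck_on_SucI[OF assms has_derivative_mult[OF Ck_on_has_derivative Ck_on_has_derivative]])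
    show "Ck_on k S (\<lambda>x. f x * frechet_derivative h (at x) v + frechet_derivative f (at x) v * h x)"
      for v
      using Suc.prems Ck_on_SucD[OF Suc.prems(1)] Ck_on_SucD[OF Suc.prems(2)]
      by (intro Ck_on_add[OF assms] Suc.IH) simp_all
  qed (use Suc.prems in auto)
qed (auto intro: continuous_intros)

lemma Ck_on_sum:
  assumes "open S" "finite I" "\<And>i. i \<in> I \<Longrightarrow> Ck_on k S (f i)"
  shows "Ck_on k S (\<lambda>x. \<Sum>i\<in>I. f i x)"
  using assms(2,3) by (induction I) (auto intro: Ck_on_const Ck_on_add \<open>open S\<close>)

text \<open>In an orthonormal basis \<open>b\<close> of the intermediate space, the derivative of \<open>F \<circ> h\<close> is the
  sum of the products of the partial derivatives of \<open>F\<close>, taken along \<open>h\<close>, with the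
  components of the derivative of \<open>h\<close>; this makes the induction on the order go through.\<close>

lemma Ck_on_compose:
  fixes h :: "'v::real_normed_vector \<Rightarrow> 'w::euclidean_space" and F :: "'w \<Rightarrow> real"
  assumes "open S" "h ` S \<subseteq> T"
  shows "Ck_on k S h \<Longrightarrow> Ck_on k T F \<Longrightarrow> Ck_on k S (\<lambda>x. F (h x))"
proof (induction k arbitrary: F)
  case 0
  then show ?case
    using assms by (auto intro: continuous_on_compose2)
next
  case (Suc k)
  have der: "((\<lambda>x. F (h x)) has_derivative
      (\<lambda>v. frechet_derivative F (at (h x)) (frechet_derivative h (at x) v))) (at x)"
    if "x \<in> S" for x
    using that assms Suc.prems
    by (auto intro!: has_derivative_compose[OF Ck_on_has_derivative Ck_on_has_derivative]
        simp del: Ck_on.simps(2))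
  have expand: "frechet_derivative F (at (h x)) w =
      (\<Sum>b\<in>Basis. (w \<bullet> b) * frechet_derivative F (at (h x)) b)" if "x \<in> S" for x w
  proof -
    have lin: "linear (frechet_derivative F (at (h x)))"
      using has_derivative_linear[OF Ck_on_has_derivative[OF Suc.prems(2)]] that assms(2) by blast
    have "frechet_derivative F (at (h x)) w =
        frechet_derivative F (at (h x)) (\<Sum>b\<in>Basis. (w \<bullet> b) *\<^sub>R b)"
      by (simp add: euclidean_representation)
    then show ?thesis
      by (simp add: linear_sum[OF lin] linear_scale[OF lin])
  qed
  have Ck: "Ck_on k S (\<lambda>x. frechet_derivative F (at (h x)) (frechet_derivative h (at x) v))" for v
  proof (rule Ck_on_cong[OF \<open>open S\<close> expand[symmetric]])
    show "Ck_on k S (\<lambda>x. \<Sum>b\<in>Basis. (frechet_derivative h (at x) v \<bullet> b) *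
        frechet_derivative F (at (h x)) b)"
      using Suc.prems Ck_on_SucD[OF Suc.prems(1)]
      by (intro Ck_on_sum Ck_on_mult Suc.IH Ck_on_linear[OF _ bounded_linear_inner_left] \<open>open S\<close>)
        auto
  qed
  show ?case
    by (rule Ck_on_SucI[OF \<open>open S\<close> der Ck])
qed

lemma smooth_on_subset: "smooth_on S f \<Longrightarrow> T \<subseteq> S \<Longrightarrow> smooth_on T f"
  by (auto simp: smooth_on_def intro: Ck_on_subset)

lemma smooth_on_cong:
  "open S \<Longrightarrow> (\<And>x. x \<in> S \<Longrightarrow> f x = f' x) \<Longrightarrow> smooth_on S f \<Longrightarrow> smooth_on S f'"
  unfolding smooth_on_def using Ck_on_cong by blast

lemma smooth_on_compose:
  fixes h :: "'v::real_normed_vector \<Rightarrow> 'w::euclidean_space" and F :: "'w \<Rightarrow> real"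
  shows "open S \<Longrightarrow> h ` S \<subseteq> T \<Longrightarrow> smooth_on S h \<Longrightarrow> smooth_on T F \<Longrightarrow> smooth_on S (\<lambda>x. F (h x))"
  unfolding smooth_on_def using Ck_on_compose by blast

lemma smooth_on_has_derivative:
  "smooth_on S f \<Longrightarrow> x \<in> S \<Longrightarrow> (f has_derivative frechet_derivative f (at x)) (at x)"
  using Ck_on_has_derivative unfolding smooth_on_def by blast

lemma smooth_on_frechet_derivative:
  "smooth_on S f \<Longrightarrow> smooth_on S (\<lambda>x. frechet_derivative f (at x) v)"
  unfolding smooth_on_def using Ck_on.simps(2) by blast

section \<open>Smooth functions and tangent spaces of a manifold\<close>

lemma tvec_eqI: "(\<And>f. dapp v f = dapp w f) \<Longrightarrow> v = w"
  by (simp add: dapp_inject[symmetric] fun_eq_iff)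

lemma dapp_simps [simp]:
  "dapp (v + w) f = dapp v f + dapp w f" "dapp (v - w) f = dapp v f - dapp w f"
  "dapp (- v) f = - dapp v f" "dapp 0 f = 0" "dapp (r *\<^sub>R v) f = r * dapp v f"
  by (transfer; simp)+

lemma dapp_sum: "dapp (\<Sum>i\<in>I. v i) f = (\<Sum>i\<in>I. dapp (v i) f)"
  by (induction I rule: infinite_finite_induct) auto

locale manifold =
  fixes A :: "('a::{t2_space, second_countable_topology}, 'm::finite) chart set"
  assumes smooth_manifold: "smooth_manifold A"
begin

lemma chart_image_open:
  assumes "(U, \<psi>) \<in> A" "open W"
  shows "open (\<psi> ` (U \<inter> W))"
proof -
  have h: "open U" "open (\<psi> ` U)" "homeomorphism U (\<psi> ` U) \<psi> (inv_into U \<psi>)"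
    using smooth_manifold assms(1) by (auto simp: smooth_manifold_def is_chart_def)
  have "openin (top_of_set (\<psi> ` U)) (\<psi> ` (U \<inter> W))"
    using homeomorphism_imp_open_map[OF h(3)] assms(2) h(1)
    by (simp add: openin_open_Int)
  then show ?thesis
    using h(2) openin_open_trans by blast
qed

lemma chart_open: "(U, \<psi>) \<in> A \<Longrightarrow> open U"
  using smooth_manifold by (auto simp: smooth_manifold_def is_chart_def)

lemma chart_inv: "(U, \<psi>) \<in> A \<Longrightarrow> p \<in> U \<Longrightarrow> inv_into U \<psi> (\<psi> p) = p"
  using smooth_manifold
  by (fastforce simp: smooth_manifold_def is_chart_def homeomorphism_def)

lemma chart_around: "\<exists>U \<psi>. (U, \<psi>) \<in> A \<and> p \<in> U"
proof -
  have "p \<in> (\<Union>c\<in>A. fst c)"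
    using smooth_manifold by (auto simp: smooth_manifold_def)
  then show ?thesis by force
qed

lemma transition_smooth:
  "(U, \<psi>) \<in> A \<Longrightarrow> (V, \<rho>) \<in> A \<Longrightarrow> smooth_on (\<psi> ` (U \<inter> V)) (\<rho> \<circ> inv_into U \<psi>)"
  using smooth_manifold unfolding smooth_manifold_def compatible_def by fast

lemma smooth_fun_on_open: "smooth_fun_on A W f \<Longrightarrow> open W"
  by (simp add: smooth_fun_on_def)

lemma smooth_fun_onD:
  "smooth_fun_on A W f \<Longrightarrow> (U, \<psi>) \<in> A \<Longrightarrow> smooth_on (\<psi> ` (U \<inter> W)) (f \<circ> inv_into U \<psi>)"
  by (auto simp: smooth_fun_on_def)

lemma smooth_fun_on_subset:
  assumes "smooth_fun_on A W f" "V \<subseteq> W" "open V"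
  shows "smooth_fun_on A V f"
  unfolding smooth_fun_on_def
proof (intro conjI ballI, safe)
  show "smooth_on (\<psi> ` (U \<inter> V)) (f \<circ> inv_into U \<psi>)" if "(U, \<psi>) \<in> A" for U \<psi>
    by (rule smooth_on_subset[OF smooth_fun_onD[OF assms(1) that]]) (use assms(2) in auto)
qed (use assms(3) in auto)

text \<open>All smoothness notions below look only at values on the open set in question. Total functions
  that represent the same local object therefore have to be exchanged by congruence rules.\<close>

lemma smooth_fun_on_cong:
  assumes "smooth_fun_on A W f" "\<And>p. p \<in> W \<Longrightarrow> f p = f' p"
  shows "smooth_fun_on A W f'"
  unfolding smooth_fun_on_def
proof (intro conjI ballI, safe)
  show "open W" using assms(1) smooth_fun_on_open by blast
  then show "smooth_on (\<psi> ` (U \<inter> W)) (f' \<circ> inv_into U \<psi>)" if "(U, \<psi>) \<in> A" for U \<psi>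
    by (intro smooth_on_cong[OF _ _ smooth_fun_onD[OF assms(1) that]])
      (auto simp: chart_inv that chart_image_open assms(2))
qed

lemma smooth_fun_on_const: "open W \<Longrightarrow> smooth_fun_on A W (\<lambda>p. r)"
  by (auto simp: smooth_fun_on_def smooth_on_def o_def intro!: Ck_on_const chart_image_open)

lemma smooth_fun_on_add:
  "smooth_fun_on A W f \<Longrightarrow> smooth_fun_on A W h \<Longrightarrow> smooth_fun_on A W (\<lambda>p. f p + h p)"
  by (auto simp: smooth_fun_on_def smooth_on_def o_def intro!: Ck_on_add chart_image_open)

lemma smooth_fun_on_mult:
  "smooth_fun_on A W f \<Longrightarrow> smooth_fun_on A W h \<Longrightarrow> smooth_fun_on A W (\<lambda>p. f p * h p)"
  by (auto simp: smooth_fun_on_def smooth_on_def o_def intro!: Ck_on_mult chart_image_open)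

lemma smooth_fun_on_near: "smooth_fun_on A W f \<Longrightarrow> p \<in> W \<Longrightarrow> smooth_near A p f"
  by (auto simp: smooth_near_def)

lemma smooth_near_cong:
  assumes "open W" "p \<in> W" "\<And>q. q \<in> W \<Longrightarrow> f q = f' q" "smooth_near A p f"
  shows "smooth_near A p f'"
proof -
  obtain V where V: "p \<in> V" "smooth_fun_on A V f"
    using assms(4) by (auto simp: smooth_near_def)
  have "smooth_fun_on A (V \<inter> W) f"
    by (rule smooth_fun_on_subset[OF V(2)]) (use assms(1) smooth_fun_on_open[OF V(2)] in auto)
  then have "smooth_fun_on A (V \<inter> W) f'"
    by (rule smooth_fun_on_cong) (use assms(3) in auto)
  then show ?thesis
    using smooth_fun_on_near \<open>p \<in> V\<close> assms(2) by blast
qed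

lemma coordinate_smooth:
  assumes "(U, \<psi>) \<in> A"
  shows "smooth_fun_on A U (\<lambda>q. \<psi> q $ m)"
  unfolding smooth_fun_on_def
proof (intro conjI ballI, safe)
  show "open U" using assms chart_open by blast
  then show "smooth_on (\<rho> ` (V \<inter> U)) ((\<lambda>q. \<psi> q $ m) \<circ> inv_into V \<rho>)" if "(V, \<rho>) \<in> A" for V \<rho>
    using transition_smooth[OF that assms] chart_image_open[OF that \<open>open U\<close>]
    by (auto simp: smooth_on_def o_def intro!: Ck_on_linear[OF _ bounded_linear_vec_nth])
qed

lemma dapp_chart_vec:
  assumes "smooth_near A p f"
  shows "dapp (chart_vec A (U, \<psi>) a p) f = frechet_derivative (f \<circ> inv_into U \<psi>) (at (\<psi> p)) a"
  using assms by (simp add: chart_vec_def Tvec_inverse)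

lemma chart_has_derivative:
  assumes "smooth_near A p f" "(U, \<psi>) \<in> A" "p \<in> U"
  shows "(f \<circ> inv_into U \<psi> has_derivative frechet_derivative (f \<circ> inv_into U \<psi>) (at (\<psi> p)))
    (at (\<psi> p))"
  using assms by (auto simp: smooth_near_def intro: smooth_on_has_derivative[OF smooth_fun_onD])

lemma chart_vec_not_smooth: "\<not> smooth_near A p f \<Longrightarrow> dapp (chart_vec A c a p) f = 0"
  by (simp add: chart_vec_def Tvec_inverse)

lemma chart_vec_linear:
  assumes "(U, \<psi>) \<in> A" "p \<in> U"
  shows "linear (\<lambda>a. chart_vec A (U, \<psi>) a p)"
proof (rule linearI; rule tvec_eqI)
  fix f a b r
  have lin: "linear (frechet_derivative (f \<circ> inv_into U \<psi>) (at (\<psi> p)))" if "smooth_near A p f"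
    using chart_has_derivative[OF that assms] has_derivative_linear by blast
  show "dapp (chart_vec A (U, \<psi>) (a + b) p) f =
      dapp (chart_vec A (U, \<psi>) a p + chart_vec A (U, \<psi>) b p) f"
    by (cases "smooth_near A p f") (simp_all add: dapp_chart_vec chart_vec_not_smooth linear_add[OF lin])
  show "dapp (chart_vec A (U, \<psi>) (r *\<^sub>R a) p) f = dapp (r *\<^sub>R chart_vec A (U, \<psi>) a p) f"
    by (cases "smooth_near A p f") (simp_all add: dapp_chart_vec chart_vec_not_smooth linear_scale[OF lin])
qed

text \<open>By the chain rule a directional derivative in one chart is the directional derivative in any
  other chart along the image of the direction under the derivative of the transition map.\<close>

lemma chart_vec_change:
  assumes "(U, \<psi>) \<in> A" "(V, \<rho>) \<in> A" "p \<in> U" "p \<in> V"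
  shows "chart_vec A (U, \<psi>) a p =
    chart_vec A (V, \<rho>) (frechet_derivative (\<rho> \<circ> inv_into U \<psi>) (at (\<psi> p)) a) p"
proof (rule tvec_eqI)
  fix f
  let ?h = "\<rho> \<circ> inv_into U \<psi>"
  show "dapp (chart_vec A (U, \<psi>) a p) f =
      dapp (chart_vec A (V, \<rho>) (frechet_derivative ?h (at (\<psi> p)) a) p) f"
  proof (cases "smooth_near A p f")
    case True
    have "(?h has_derivative frechet_derivative ?h (at (\<psi> p))) (at (\<psi> p))"
      by (rule smooth_on_has_derivative[OF transition_smooth]) (use assms in auto)
    moreover have "(f \<circ> inv_into V \<rho> has_derivative frechet_derivative (f \<circ> inv_into V \<rho>) (at (\<rho> p)))
        (at (?h (\<psi> p)))"
      using chart_has_derivative[OF True assms(2,4)] assms by (simp add: chart_inv)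
    ultimately have "((\<lambda>x. (f \<circ> inv_into V \<rho>) (?h x)) has_derivative
        (\<lambda>v. frechet_derivative (f \<circ> inv_into V \<rho>) (at (\<rho> p)) (frechet_derivative ?h (at (\<psi> p)) v)))
        (at (\<psi> p))"
      by (rule has_derivative_compose)
    then have "(f \<circ> inv_into U \<psi> has_derivative
        (\<lambda>v. frechet_derivative (f \<circ> inv_into V \<rho>) (at (\<rho> p)) (frechet_derivative ?h (at (\<psi> p)) v)))
        (at (\<psi> p))"
      by (rule has_derivative_transform_within_open[OF _ chart_image_open[OF assms(1) chart_open[OF assms(2)]]])
        (use assms in \<open>auto simp: chart_inv\<close>)
    then show ?thesis
      by (simp add: dapp_chart_vec[OF True] frechet_derivative_at[symmetric])
  qed (simp add: chart_vec_not_smooth)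
qed

text \<open>Tangent vectors are collected over all charts around the point; one chart gives them all. This
  is what makes the tangent space closed under addition.\<close>

lemma tangent_space_chart:
  assumes "(U, \<psi>) \<in> A" "p \<in> U"
  shows "tangent_space A p = range (\<lambda>a. chart_vec A (U, \<psi>) a p)"
proof (intro equalityI subsetI)
  fix v assume "v \<in> tangent_space A p"
  then obtain V \<rho> a where "(V, \<rho>) \<in> A" "p \<in> V" "v = chart_vec A (V, \<rho>) a p"
    by (auto simp: tangent_space_def)
  then show "v \<in> range (\<lambda>a. chart_vec A (U, \<psi>) a p)"
    using chart_vec_change[OF _ assms(1) _ assms(2)] by blast
next
  fix v assume "v \<in> range (\<lambda>a. chart_vec A (U, \<psi>) a p)"
  then obtain a where "v = chart_vec A (U, \<psi>) a p"
    by blast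
  moreover have "p \<in> fst (U, \<psi>)"
    using assms(2) by simp
  ultimately show "v \<in> tangent_space A p"
    using assms(1) unfolding tangent_space_def by blast
qed

lemma tangent_subspace: "subspace (tangent_space A p)"
proof -
  obtain U \<psi> where "(U, \<psi>) \<in> A" "p \<in> U"
    using chart_around by blast
  then show ?thesis
    using tangent_space_chart linear_subspace_image[OF chart_vec_linear subspace_UNIV] by simp
qed

lemmas tangent_add = subspace_add[OF tangent_subspace]
  and tangent_diff = subspace_diff[OF tangent_subspace]
  and tangent_neg = subspace_neg[OF tangent_subspace]
  and tangent_scale = subspace_scale[OF tangent_subspace]
  and tangent_zero = subspace_0[OF tangent_subspace]
  and tangent_sum = subspace_sum[OF tangent_subspace]

lemma dapp_chart_vec_coordinate:
  assumes "(U, \<psi>) \<in> A" "p \<in> U"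
  shows "dapp (chart_vec A (U, \<psi>) a p) (\<lambda>q. \<psi> q $ m) = a $ m"
proof -
  have "((\<lambda>q. \<psi> q $ m) \<circ> inv_into U \<psi> has_derivative (\<lambda>y. y $ m)) (at (\<psi> p))"
    by (rule has_derivative_transform_within_open[OF
          bounded_linear_imp_has_derivative[OF bounded_linear_vec_nth]
          chart_image_open[OF assms(1) chart_open[OF assms(1)]]])
      (use assms in \<open>auto simp: chart_inv\<close>)
  moreover have "smooth_near A p (\<lambda>q. \<psi> q $ m)"
    using smooth_fun_on_near[OF coordinate_smooth] assms by blast
  ultimately show ?thesis
    by (simp add: dapp_chart_vec frechet_derivative_at[symmetric])
qed

lemma dapp_coord_field:
  assumes "(U, \<psi>) \<in> A" "p \<in> U"
  shows "dapp (coord_field A (U, \<psi>) i p) (\<lambda>q. \<psi> q $ m) = (if i = m then 1 else 0)"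
  by (simp add: coord_field_def dapp_chart_vec_coordinate[OF assms] axis_def)

text \<open>A tangent vector is recovered from its action on the coordinate functions. This reduces
  statements about brackets to derivatives of coordinates.\<close>

lemma tangent_expansion:
  assumes "(U, \<psi>) \<in> A" "p \<in> U" "v \<in> tangent_space A p"
  shows "v = (\<Sum>m\<in>UNIV. dapp v (\<lambda>q. \<psi> q $ m) *\<^sub>R coord_field A (U, \<psi>) m p)"
proof -
  obtain a where a: "v = chart_vec A (U, \<psi>) a p"
    using assms tangent_space_chart by blast
  have "a = (\<Sum>m\<in>UNIV. a $ m *\<^sub>R axis m 1)"
    by (simp add: vec_eq_iff axis_def if_distrib cong: if_cong)
  then have "v = chart_vec A (U, \<psi>) (\<Sum>m\<in>UNIV. a $ m *\<^sub>R axis m 1) p"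
    using a by simp
  also have "\<dots> = (\<Sum>m\<in>UNIV. a $ m *\<^sub>R coord_field A (U, \<psi>) m p)"
    by (simp add: coord_field_def linear_sum[OF chart_vec_linear[OF assms(1,2)]]
        linear_scale[OF chart_vec_linear[OF assms(1,2)]])
  finally show ?thesis
    unfolding a dapp_chart_vec_coordinate[OF assms(1,2)] .
qed

text \<open>Tangent vectors are local operators, so derivatives of functions that are known only on a chart
  domain can be computed.\<close>

lemma dapp_cong:
  assumes "v \<in> tangent_space A p" "open W" "p \<in> W" "\<And>q. q \<in> W \<Longrightarrow> f q = f' q"
  shows "dapp v f = dapp v f'"
proof -
  obtain U \<psi> a where c: "(U, \<psi>) \<in> A" "p \<in> U" "v = chart_vec A (U, \<psi>) a p"
    using assms(1) by (auto simp: tangent_space_def)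
  have iff: "smooth_near A p f \<longleftrightarrow> smooth_near A p f'"
    using smooth_near_cong assms by metis
  show ?thesis
  proof (cases "smooth_near A p f")
    case True
    have "(f' \<circ> inv_into U \<psi> has_derivative frechet_derivative (f \<circ> inv_into U \<psi>) (at (\<psi> p)))
        (at (\<psi> p))"
      by (rule has_derivative_transform_within_open[OF chart_has_derivative[OF True c(1,2)]
            chart_image_open[OF c(1) assms(2)]])
        (use assms c in \<open>auto simp: chart_inv\<close>)
    then show ?thesis
      using True iff by (simp add: c dapp_chart_vec frechet_derivative_at[symmetric])
  qed (use iff in \<open>simp add: c chart_vec_not_smooth\<close>)
qed

lemma dapp_const:
  assumes "v \<in> tangent_space A p" "open W" "p \<in> W" "\<And>q. q \<in> W \<Longrightarrow> f q = r"
  shows "dapp v f = 0"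
proof -
  obtain U \<psi> a where c: "v = chart_vec A (U, \<psi>) a p"
    using assms(1) by (auto simp: tangent_space_def)
  have "dapp v f = dapp v (\<lambda>_. r)"
    using dapp_cong[OF assms] .
  also have "\<dots> = 0"
    using smooth_fun_on_near[OF smooth_fun_on_const[OF open_UNIV]]
    by (simp add: c dapp_chart_vec o_def)
  finally show ?thesis .
qed

section \<open>Vector fields and connections\<close>

lemma vector_field_onI:
  assumes "open W" "\<And>p. p \<in> W \<Longrightarrow> X p \<in> tangent_space A p"
    and "\<And>V f. V \<subseteq> W \<Longrightarrow> smooth_fun_on A V f \<Longrightarrow> smooth_fun_on A V (\<lambda>p. dapp (X p) f)"
  shows "vector_field_on A W X"
  using assms unfolding vector_field_on_def by blast

lemma vector_field_tangent: "vector_field_on A W X \<Longrightarrow> p \<in> W \<Longrightarrow> X p \<in> tangent_space A p"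
  unfolding vector_field_on_def by blast

lemma vector_field_open: "vector_field_on A W X \<Longrightarrow> open W"
  unfolding vector_field_on_def by blast

lemma vector_field_smooth:
  "vector_field_on A W X \<Longrightarrow> V \<subseteq> W \<Longrightarrow> smooth_fun_on A V f \<Longrightarrow> smooth_fun_on A V (\<lambda>p. dapp (X p) f)"
  unfolding vector_field_on_def by blast

lemma vector_field_subset:
  "vector_field_on A W X \<Longrightarrow> V \<subseteq> W \<Longrightarrow> open V \<Longrightarrow> vector_field_on A V X"
  unfolding vector_field_on_def by blast

lemma vector_field_zero: "open W \<Longrightarrow> vector_field_on A W (\<lambda>p. 0)"
  by (rule vector_field_onI) (simp_all add: tangent_zero smooth_fun_on_const[OF smooth_fun_on_open])

lemma vector_field_cong:
  assumes "vector_field_on A W X" "\<And>p. p \<in> W \<Longrightarrow> X p = Y p"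
  shows "vector_field_on A W Y"
proof (rule vector_field_onI)
  show "Y p \<in> tangent_space A p" if "p \<in> W" for p
    using vector_field_tangent[OF assms(1) that] assms(2)[OF that] by simp
  show "smooth_fun_on A V (\<lambda>p. dapp (Y p) f)" if "V \<subseteq> W" "smooth_fun_on A V f" for V f
    by (rule smooth_fun_on_cong[OF vector_field_smooth[OF assms(1) that]]) (use assms(2) that in auto)
qed (rule vector_field_open[OF assms(1)])

lemma vector_field_add:
  assumes "vector_field_on A W X" "vector_field_on A W Y"
  shows "vector_field_on A W (\<lambda>p. X p + Y p)"
proof (rule vector_field_onI)
  show "X p + Y p \<in> tangent_space A p" if "p \<in> W" for p
    using tangent_add vector_field_tangent[OF _ that] assms by blast
  show "smooth_fun_on A V (\<lambda>p. dapp (X p + Y p) f)" if "V \<subseteq> W" "smooth_fun_on A V f" for V f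
    unfolding dapp_simps
    by (rule smooth_fun_on_add[OF vector_field_smooth[OF assms(1) that] vector_field_smooth[OF assms(2) that]])
qed (rule vector_field_open[OF assms(1)])

lemma vector_field_scale:
  assumes "smooth_fun_on A W f" "vector_field_on A W X"
  shows "vector_field_on A W (\<lambda>p. f p *\<^sub>R X p)"
proof (rule vector_field_onI)
  show "f p *\<^sub>R X p \<in> tangent_space A p" if "p \<in> W" for p
    using tangent_scale vector_field_tangent[OF assms(2) that] by blast
  show "smooth_fun_on A V (\<lambda>p. dapp (f p *\<^sub>R X p) h)" if "V \<subseteq> W" "smooth_fun_on A V h" for V h
    unfolding dapp_simps
    by (rule smooth_fun_on_mult[OF smooth_fun_on_subset[OF assms(1) that(1) smooth_fun_on_open[OF that(2)]]
          vector_field_smooth[OF assms(2) that]])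
qed (rule vector_field_open[OF assms(2)])

lemma vector_field_diff:
  assumes "vector_field_on A W X" "vector_field_on A W Y"
  shows "vector_field_on A W (\<lambda>p. X p - Y p)"
  using vector_field_add[OF assms(1) vector_field_scale[OF smooth_fun_on_const assms(2), of "- 1"]]
    vector_field_open[OF assms(1)] by simp

lemma vector_field_sum:
  "open W \<Longrightarrow> (\<And>i. i \<in> I \<Longrightarrow> vector_field_on A W (X i)) \<Longrightarrow> vector_field_on A W (\<lambda>p. \<Sum>i\<in>I. X i p)"
  by (induction I rule: infinite_finite_induct) (simp_all add: vector_field_zero vector_field_add)

text \<open>The derivative along a coordinate field is a partial derivative in its own chart, and in any
  other chart it is that partial derivative composed with the transition map.\<close>

lemma coord_vector_field:
  assumes "(U, \<psi>) \<in> A"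
  shows "vector_field_on A U (coord_field A (U, \<psi>) m)"
proof (rule vector_field_onI)
  show "open U" using assms chart_open by blast
  show "coord_field A (U, \<psi>) m p \<in> tangent_space A p" if "p \<in> U" for p
    using tangent_space_chart[OF assms that] by (auto simp: coord_field_def)
  fix W f assume W: "W \<subseteq> U" and f: "smooth_fun_on A W f"
  let ?F = "\<lambda>y. frechet_derivative (f \<circ> inv_into U \<psi>) (at y) (axis m 1)"
  have F: "smooth_on (\<psi> ` (U \<inter> W)) ?F"
    by (rule smooth_on_frechet_derivative[OF smooth_fun_onD[OF f assms]])
  have "smooth_fun_on A W (\<lambda>p. ?F (\<psi> p))"
    unfolding smooth_fun_on_def
  proof (intro conjI ballI, safe)
    show "open W" using f smooth_fun_on_open by blast
    fix V \<rho> assume V: "(V, \<rho>) \<in> A"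
    have "smooth_on (\<rho> ` (V \<inter> W)) (\<psi> \<circ> inv_into V \<rho>)"
      by (rule smooth_on_subset[OF transition_smooth[OF V assms]]) (use W in auto)
    moreover have "(\<psi> \<circ> inv_into V \<rho>) ` (\<rho> ` (V \<inter> W)) \<subseteq> \<psi> ` (U \<inter> W)"
      using W by (auto simp: chart_inv[OF V])
    ultimately show "smooth_on (\<rho> ` (V \<inter> W)) ((\<lambda>p. ?F (\<psi> p)) \<circ> inv_into V \<rho>)"
      using smooth_on_compose[OF chart_image_open[OF V \<open>open W\<close>] _ _ F] by (simp add: o_def)
  qed
  then show "smooth_fun_on A W (\<lambda>p. dapp (coord_field A (U, \<psi>) m p) f)"
    using smooth_fun_on_near[OF f]
    by (auto elim!: smooth_fun_on_cong simp: coord_field_def dapp_chart_vec)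
qed


context
  fixes U :: "'a set" and D :: "('a \<Rightarrow> 'a tvec) \<Rightarrow> ('a \<Rightarrow> 'a tvec) \<Rightarrow> 'a \<Rightarrow> 'a tvec"
  assumes conn: "linear_connection_on A U D"
begin

lemma connection_field:
  "W \<subseteq> U \<Longrightarrow> vector_field_on A W X \<Longrightarrow> vector_field_on A W Y \<Longrightarrow> vector_field_on A W (D X Y)"
  using conn unfolding linear_connection_on_def by blast

lemma connection_add_left:
  "W \<subseteq> U \<Longrightarrow> vector_field_on A W X \<Longrightarrow> vector_field_on A W Z \<Longrightarrow> vector_field_on A W Y \<Longrightarrow> p \<in> W \<Longrightarrow>
    D (\<lambda>q. X q + Z q) Y p = D X Y p + D Z Y p"
  using conn unfolding linear_connection_on_def by blast

lemma connection_add_right: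
  "W \<subseteq> U \<Longrightarrow> vector_field_on A W X \<Longrightarrow> vector_field_on A W Y \<Longrightarrow> vector_field_on A W Z \<Longrightarrow> p \<in> W \<Longrightarrow>
    D X (\<lambda>q. Y q + Z q) p = D X Y p + D X Z p"
  using conn unfolding linear_connection_on_def by blast

lemma connection_scale_left:
  "W \<subseteq> U \<Longrightarrow> vector_field_on A W X \<Longrightarrow> vector_field_on A W Y \<Longrightarrow> smooth_fun_on A W f \<Longrightarrow> p \<in> W \<Longrightarrow>
    D (\<lambda>q. f q *\<^sub>R X q) Y p = f p *\<^sub>R D X Y p"
  using conn unfolding linear_connection_on_def by blast

lemma connection_scale_right:
  "W \<subseteq> U \<Longrightarrow> vector_field_on A W X \<Longrightarrow> vector_field_on A W Y \<Longrightarrow> smooth_fun_on A W f \<Longrightarrow> p \<in> W \<Longrightarrow>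
    D X (\<lambda>q. f q *\<^sub>R Y q) p = f p *\<^sub>R D X Y p + dapp (X p) f *\<^sub>R Y p"
  using conn unfolding linear_connection_on_def by blast

lemma connection_zero_left:
  assumes "W \<subseteq> U" "vector_field_on A W Y" "p \<in> W"
  shows "D (\<lambda>q. 0) Y p = 0"
  using connection_scale_left[OF assms(1,2,2) smooth_fun_on_const[OF vector_field_open[OF assms(2)]] assms(3), of 0]
  by simp

lemma connection_zero_right:
  assumes "W \<subseteq> U" "vector_field_on A W X" "p \<in> W"
  shows "D X (\<lambda>q. 0) p = 0"
  using connection_add_right[OF assms(1,2) vector_field_zero vector_field_zero assms(3)]
    vector_field_open[OF assms(2)] by simp

text \<open>Two fields that agree on \<open>W\<close> differ by the multiple of a field by a function that vanishes on
  \<open>W\<close> and is \<open>1\<close> elsewhere. That function is smooth on \<open>W\<close>, so the product rules remove it.\<close>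

lemma connection_cong_left:
  assumes W: "W \<subseteq> U" and X: "vector_field_on A W X" and Y: "vector_field_on A W Y" and p: "p \<in> W"
    and eq: "\<And>q. q \<in> W \<Longrightarrow> X q = X' q"
  shows "D X Y p = D X' Y p"
proof -
  let ?f = "\<lambda>q. if q \<in> W then 0 else 1 :: real"
  have X': "vector_field_on A W X'"
    using vector_field_cong[OF X eq] .
  have f: "smooth_fun_on A W ?f"
    by (rule smooth_fun_on_cong[OF smooth_fun_on_const[OF vector_field_open[OF X], of 0]]) simp
  have "X = (\<lambda>q. X' q + ?f q *\<^sub>R (X q - X' q))"
    using eq by (simp add: fun_eq_iff)
  then have "D X Y p = D (\<lambda>q. X' q + ?f q *\<^sub>R (X q - X' q)) Y p"
    by simp
  also have "\<dots> = D X' Y p + ?f p *\<^sub>R D (\<lambda>q. X q - X' q) Y p"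
    using connection_add_left[OF W X' vector_field_scale[OF f vector_field_diff[OF X X']] Y p]
      connection_scale_left[OF W vector_field_diff[OF X X'] Y f p] by simp
  finally show ?thesis
    using p by simp
qed

lemma connection_cong_right:
  assumes W: "W \<subseteq> U" and X: "vector_field_on A W X" and Y: "vector_field_on A W Y" and p: "p \<in> W"
    and eq: "\<And>q. q \<in> W \<Longrightarrow> Y q = Y' q"
  shows "D X Y p = D X Y' p"
proof -
  let ?f = "\<lambda>q. if q \<in> W then 0 else 1 :: real"
  have Y': "vector_field_on A W Y'"
    using vector_field_cong[OF Y eq] .
  have f: "smooth_fun_on A W ?f"
    by (rule smooth_fun_on_cong[OF smooth_fun_on_const[OF vector_field_open[OF X], of 0]]) simp
  have "Y = (\<lambda>q. Y' q + ?f q *\<^sub>R (Y q - Y' q))"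
    using eq by (simp add: fun_eq_iff)
  then have "D X Y p = D X (\<lambda>q. Y' q + ?f q *\<^sub>R (Y q - Y' q)) p"
    by simp
  also have "\<dots> = D X Y' p + (?f p *\<^sub>R D X (\<lambda>q. Y q - Y' q) p + dapp (X p) ?f *\<^sub>R (Y p - Y' p))"
    using connection_add_right[OF W X Y' vector_field_scale[OF f vector_field_diff[OF Y Y']] p]
      connection_scale_right[OF W X vector_field_diff[OF Y Y'] f p] by simp
  finally show ?thesis
    using p eq[OF p] by simp
qed

lemma connection_sum_left:
  assumes W: "W \<subseteq> U" and Y: "vector_field_on A W Y" and p: "p \<in> W"
    and e: "\<And>s. s \<in> S \<Longrightarrow> smooth_fun_on A W (f s)" "\<And>s. s \<in> S \<Longrightarrow> vector_field_on A W (e s)"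
  shows "D (\<lambda>q. \<Sum>s\<in>S. f s q *\<^sub>R e s q) Y p = (\<Sum>s\<in>S. f s p *\<^sub>R D (e s) Y p)"
  using e
proof (induction S rule: infinite_finite_induct)
  case (insert s S)
  have "D (\<lambda>q. f s q *\<^sub>R e s q + (\<Sum>s\<in>S. f s q *\<^sub>R e s q)) Y p =
      D (\<lambda>q. f s q *\<^sub>R e s q) Y p + D (\<lambda>q. \<Sum>s\<in>S. f s q *\<^sub>R e s q) Y p"
    using insert.prems vector_field_open[OF Y]
    by (intro connection_add_left[OF W _ _ Y p] vector_field_scale vector_field_sum) auto
  then show ?case
    using insert connection_scale_left[OF W _ Y _ p] by simp
qed (simp_all add: connection_zero_left[OF W Y p])

lemma connection_sum_right:
  assumes W: "W \<subseteq> U" and X: "vector_field_on A W X" and p: "p \<in> W"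
    and e: "\<And>s. s \<in> S \<Longrightarrow> smooth_fun_on A W (f s)" "\<And>s. s \<in> S \<Longrightarrow> vector_field_on A W (e s)"
  shows "D X (\<lambda>q. \<Sum>s\<in>S. f s q *\<^sub>R e s q) p =
    (\<Sum>s\<in>S. f s p *\<^sub>R D X (e s) p + dapp (X p) (f s) *\<^sub>R e s p)"
  using e
proof (induction S rule: infinite_finite_induct)
  case (insert s S)
  have "D X (\<lambda>q. f s q *\<^sub>R e s q + (\<Sum>s\<in>S. f s q *\<^sub>R e s q)) p =
      D X (\<lambda>q. f s q *\<^sub>R e s q) p + D X (\<lambda>q. \<Sum>s\<in>S. f s q *\<^sub>R e s q) p"
    using insert.prems vector_field_open[OF X]
    by (intro connection_add_right[OF W X _ _ p] vector_field_scale vector_field_sum) auto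
  then show ?case
    using insert connection_scale_right[OF W X _ _ p] by simp
qed (simp_all add: connection_zero_right[OF W X p])

text \<open>A connection is tensorial in the first argument and a derivation in the second, so on combinations
  of frame fields it is an expression in its values on the frame and the coefficients.\<close>

lemma connection_frame:
  assumes W: "W \<subseteq> U" and X: "vector_field_on A W X" and Y: "vector_field_on A W Y" and p: "p \<in> W"
    and e: "\<And>s. s \<in> S \<Longrightarrow> vector_field_on A W (e s)"
    and a: "\<And>s. s \<in> S \<Longrightarrow> smooth_fun_on A W (a s)" "\<And>q. q \<in> W \<Longrightarrow> X q = (\<Sum>s\<in>S. a s q *\<^sub>R e s q)"
    and b: "\<And>s. s \<in> S \<Longrightarrow> smooth_fun_on A W (b s)" "\<And>q. q \<in> W \<Longrightarrow> Y q = (\<Sum>s\<in>S. b s q *\<^sub>R e s q)"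
  shows "D X Y p = (\<Sum>t\<in>S. b t p *\<^sub>R (\<Sum>s\<in>S. a s p *\<^sub>R D (e s) (e t) p) + dapp (X p) (b t) *\<^sub>R e t p)"
proof -
  have left: "D X (e t) p = (\<Sum>s\<in>S. a s p *\<^sub>R D (e s) (e t) p)" if "t \<in> S" for t
    using connection_cong_left[OF W X e[OF that] p a(2)]
      connection_sum_left[OF W e[OF that] p a(1) e] by simp
  have "D X Y p = D X (\<lambda>q. \<Sum>s\<in>S. b s q *\<^sub>R e s q) p"
    using connection_cong_right[OF W X Y p b(2)] by simp
  also have "\<dots> = (\<Sum>t\<in>S. b t p *\<^sub>R D X (e t) p + dapp (X p) (b t) *\<^sub>R e t p)"
    by (rule connection_sum_right[OF W X p b(1) e])
  finally show ?thesis
    by (simp add: left)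
qed

end

lemma connection_determined_by_frame:
  assumes conns: "linear_connection_on A U D" "linear_connection_on A U' E"
    and W: "W \<subseteq> U" "W \<subseteq> U'" and "vector_field_on A W X" "vector_field_on A W Y" "p \<in> W"
    and "\<And>s. s \<in> S \<Longrightarrow> vector_field_on A W (e s)"
    and "\<And>s. s \<in> S \<Longrightarrow> smooth_fun_on A W (a s)" "\<And>q. q \<in> W \<Longrightarrow> X q = (\<Sum>s\<in>S. a s q *\<^sub>R e s q)"
    and "\<And>s. s \<in> S \<Longrightarrow> smooth_fun_on A W (b s)" "\<And>q. q \<in> W \<Longrightarrow> Y q = (\<Sum>s\<in>S. b s q *\<^sub>R e s q)"
    and eq: "\<And>s t. s \<in> S \<Longrightarrow> t \<in> S \<Longrightarrow> D (e s) (e t) p = E (e s) (e t) p"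
  shows "D X Y p = E X Y p"
proof -
  have "D X Y p = (\<Sum>t\<in>S. b t p *\<^sub>R (\<Sum>s\<in>S. a s p *\<^sub>R D (e s) (e t) p) + dapp (X p) (b t) *\<^sub>R e t p)"
    by (rule connection_frame[OF conns(1) W(1) assms(5-12)])
  also have "\<dots> = (\<Sum>t\<in>S. b t p *\<^sub>R (\<Sum>s\<in>S. a s p *\<^sub>R E (e s) (e t) p) + dapp (X p) (b t) *\<^sub>R e t p)"
    by (simp add: eq)
  also have "\<dots> = E X Y p"
    by (rule connection_frame[OF conns(2) W(2) assms(5-12), symmetric])
  finally show ?thesis .
qed

end

section \<open>Inverting a block of a matrix\<close>

text \<open>The inverse is chosen by description, so only its existence matters. Extending the block by the
  identity to the whole finite index type keeps the kernel trivial, and an injective square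
  matrix has a two-sided inverse, of which the block over \<open>I\<close> is an inverse of \<open>G\<close>.\<close>

lemma inverse_matrix_on_left:
  fixes G :: "'i::finite \<Rightarrow> 'i \<Rightarrow> real"
  assumes inj: "\<And>x. (\<And>i. i \<in> I \<Longrightarrow> (\<Sum>k\<in>I. G i k * x k) = 0) \<Longrightarrow> (\<And>i. i \<in> I \<Longrightarrow> x i = 0)"
    and "i \<in> I" "j \<in> I"
  shows "(\<Sum>k\<in>I. inverse_matrix_on I G i k * G k j) = (if i = j then 1 else 0)"
proof -
  define M :: "real^'i^'i"
    where "M = (\<chi> i j. if i \<in> I \<and> j \<in> I then G i j else if i = j then 1 else 0)"
  have block: "(\<Sum>k\<in>UNIV. M $ i $ k * y k) = (\<Sum>k\<in>I. G i k * y k)"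
    "(\<Sum>k\<in>UNIV. y k * M $ k $ i) = (\<Sum>k\<in>I. y k * G k i)" if "i \<in> I" for i y
    using that by (auto simp: M_def intro!: sum.mono_neutral_cong_right)
  have "x = 0" if x: "M *v x = 0" for x
  proof -
    have comp: "(\<Sum>k\<in>UNIV. M $ i $ k * x $ k) = 0" for i
      using x by (simp add: matrix_vector_mult_def vec_eq_iff)
    have "x $ i = 0" for i
    proof (cases "i \<in> I")
      case True
      then show ?thesis
        using inj[of "\<lambda>k. x $ k"] comp block(1) by metis
    next
      case False
      have "(\<Sum>k\<in>UNIV. M $ i $ k * x $ k) = (\<Sum>k\<in>UNIV. if k = i then x $ k else 0)"
        using False by (intro sum.cong) (auto simp: M_def)
      then show ?thesis
        using comp[of i] by simp
    qed
    then show ?thesis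
      by (simp add: vec_eq_iff)
  qed
  then obtain B where B: "B ** M = mat 1" "M ** B = mat 1"
    using matrix_left_invertible_ker[of M] matrix_left_right_inverse by blast
  have "\<exists>B. \<forall>i\<in>I. \<forall>j\<in>I.
     (\<Sum>k\<in>I. B i k * G k j) = (if i = j then 1 else 0) \<and>
     (\<Sum>k\<in>I. G i k * B k j) = (if i = j then 1 else 0)"
  proof (intro exI[of _ "\<lambda>i j. B $ i $ j"] ballI conjI)
    fix i j assume ij: "i \<in> I" "j \<in> I"
    show "(\<Sum>k\<in>I. B $ i $ k * G k j) = (if i = j then 1 else 0)"
      using arg_cong[OF B(1), of "\<lambda>N. N $ i $ j"] block(2)[OF ij(2), of "\<lambda>k. B $ i $ k"]
      by (simp add: matrix_matrix_mult_def mat_def)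
    show "(\<Sum>k\<in>I. G i k * B $ k $ j) = (if i = j then 1 else 0)"
      using arg_cong[OF B(2), of "\<lambda>N. N $ i $ j"] block(1)[OF ij(1), of "\<lambda>k. B $ k $ j"]
      by (simp add: matrix_matrix_mult_def mat_def)
  qed
  from someI_ex[OF this] show ?thesis
    using assms(2,3) unfolding inverse_matrix_on_def by blast
qed


section \<open>Pointwise algebra of a 3-Sasakian structure\<close>

locale three_sasakian_manifold = manifold A
  for A :: "('a::{t2_space, second_countable_topology}, 'm::finite) chart set" +
  fixes n :: nat and g :: "'a \<Rightarrow> 'a tvec \<Rightarrow> 'a tvec \<Rightarrow> real"
    and D :: "('a \<Rightarrow> 'a tvec) \<Rightarrow> ('a \<Rightarrow> 'a tvec) \<Rightarrow> 'a \<Rightarrow> 'a tvec"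
    and \<phi> :: "3 \<Rightarrow> 'a \<Rightarrow> 'a tvec \<Rightarrow> 'a tvec"
    and \<xi> :: "3 \<Rightarrow> 'a \<Rightarrow> 'a tvec"
    and \<eta> :: "3 \<Rightarrow> 'a \<Rightarrow> 'a tvec \<Rightarrow> real"
  assumes three_sasakian: "three_sasakian n A g D \<phi> \<xi> \<eta>"
begin

abbreviation "T \<equiv> tangent_space A"

lemma metric: "riemannian_metric A g"
  and levi_civita: "levi_civita A g D"
  and sasakian: "sasakian_structure A g D (\<phi> \<alpha>) (\<xi> \<alpha>) (\<eta> \<alpha>)"
  using three_sasakian unfolding three_sasakian_def by blast+

lemma g_linear:
  "u \<in> T p \<Longrightarrow> v \<in> T p \<Longrightarrow> w \<in> T p \<Longrightarrow> g p (a *\<^sub>R u + b *\<^sub>R v) w = a * g p u w + b * g p v w"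
  and g_sym: "v \<in> T p \<Longrightarrow> w \<in> T p \<Longrightarrow> g p v w = g p w v"
  and g_pos: "v \<in> T p \<Longrightarrow> v \<noteq> 0 \<Longrightarrow> g p v v > 0"
  and g_smooth: "vector_field_on A W X \<Longrightarrow> vector_field_on A W Y \<Longrightarrow>
    smooth_fun_on A W (\<lambda>p. g p (X p) (Y p))"
  using metric unfolding riemannian_metric_def by blast+

lemma g_scale: "v \<in> T p \<Longrightarrow> w \<in> T p \<Longrightarrow> g p (a *\<^sub>R v) w = a * g p v w"
  using g_linear[of v p v w a 0] by simp

lemma g_zero: "w \<in> T p \<Longrightarrow> g p 0 w = 0"
  using g_scale[of 0 p w 0] tangent_zero by simp

lemma g_add: "u \<in> T p \<Longrightarrow> v \<in> T p \<Longrightarrow> w \<in> T p \<Longrightarrow> g p (u + v) w = g p u w + g p v w"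
  using g_linear[of u p v w 1 1] by simp

lemma g_neg: "v \<in> T p \<Longrightarrow> w \<in> T p \<Longrightarrow> g p (- v) w = - g p v w"
  using g_scale[of v p w "- 1"] by simp

lemma g_diff: "u \<in> T p \<Longrightarrow> v \<in> T p \<Longrightarrow> w \<in> T p \<Longrightarrow> g p (u - v) w = g p u w - g p v w"
  using g_linear[of u p v w 1 "- 1"] by simp

lemma g_sum:
  assumes "\<And>i. i \<in> I \<Longrightarrow> v i \<in> T p" "w \<in> T p"
  shows "g p (\<Sum>i\<in>I. v i) w = (\<Sum>i\<in>I. g p (v i) w)"
  using assms(1)
  by (induction I rule: infinite_finite_induct) (auto simp: g_zero g_add assms(2) tangent_sum)

lemma g_add_right: "u \<in> T p \<Longrightarrow> v \<in> T p \<Longrightarrow> w \<in> T p \<Longrightarrow> g p w (u + v) = g p w u + g p w v"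
  and g_diff_right: "u \<in> T p \<Longrightarrow> v \<in> T p \<Longrightarrow> w \<in> T p \<Longrightarrow> g p w (u - v) = g p w u - g p w v"
  and g_neg_right: "v \<in> T p \<Longrightarrow> w \<in> T p \<Longrightarrow> g p w (- v) = - g p w v"
  and g_scale_right: "v \<in> T p \<Longrightarrow> w \<in> T p \<Longrightarrow> g p w (a *\<^sub>R v) = a * g p w v"
  and g_zero_right: "w \<in> T p \<Longrightarrow> g p w 0 = 0"
  by (simp_all add: g_sym[of w] g_add g_diff g_neg g_scale g_zero tangent_add tangent_diff
      tangent_neg tangent_scale tangent_zero)

lemma g_definite: "v \<in> T p \<Longrightarrow> g p v v = 0 \<Longrightarrow> v = 0"
  using g_pos by fastforce

lemma phi_tensor: "tensor11 A (\<phi> \<alpha>)"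
  and xi_field_UNIV: "vector_field_on A UNIV (\<xi> \<alpha>)"
  and eta_form: "one_form A (\<eta> \<alpha>)"
  and phi_square: "v \<in> T p \<Longrightarrow> \<phi> \<alpha> p (\<phi> \<alpha> p v) = - v + \<eta> \<alpha> p v *\<^sub>R \<xi> \<alpha> p"
  and eta_xi_same: "\<eta> \<alpha> p (\<xi> \<alpha> p) = 1"
  and eta_g: "v \<in> T p \<Longrightarrow> \<eta> \<alpha> p v = g p (\<xi> \<alpha> p) v"
  and g_phi_phi: "v \<in> T p \<Longrightarrow> w \<in> T p \<Longrightarrow>
    g p (\<phi> \<alpha> p v) (\<phi> \<alpha> p w) = g p v w - \<eta> \<alpha> p v * \<eta> \<alpha> p w"
  and nabla_phi: "vector_field_on A W X \<Longrightarrow> vector_field_on A W Y \<Longrightarrow> p \<in> W \<Longrightarrow>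
    D X (\<lambda>q. \<phi> \<alpha> q (Y q)) p - \<phi> \<alpha> p (D X Y p) =
      g p (X p) (Y p) *\<^sub>R \<xi> \<alpha> p - \<eta> \<alpha> p (Y p) *\<^sub>R X p"
  using sasakian[of \<alpha>] unfolding sasakian_structure_def by blast+

lemma phi_tangent: "v \<in> T p \<Longrightarrow> \<phi> \<alpha> p v \<in> T p"
  and phi_linear: "v \<in> T p \<Longrightarrow> w \<in> T p \<Longrightarrow> \<phi> \<alpha> p (a *\<^sub>R v + b *\<^sub>R w) = a *\<^sub>R \<phi> \<alpha> p v + b *\<^sub>R \<phi> \<alpha> p w"
  and phi_field: "vector_field_on A W X \<Longrightarrow> vector_field_on A W (\<lambda>p. \<phi> \<alpha> p (X p))"
  using phi_tensor[of \<alpha>] unfolding tensor11_def by blast+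

lemma phi_scale: "v \<in> T p \<Longrightarrow> \<phi> \<alpha> p (a *\<^sub>R v) = a *\<^sub>R \<phi> \<alpha> p v"
  using phi_linear[of v p v \<alpha> a 0] by simp

lemma phi_add: "v \<in> T p \<Longrightarrow> w \<in> T p \<Longrightarrow> \<phi> \<alpha> p (v + w) = \<phi> \<alpha> p v + \<phi> \<alpha> p w"
  using phi_linear[of v p w \<alpha> 1 1] by simp

lemma phi_diff: "v \<in> T p \<Longrightarrow> w \<in> T p \<Longrightarrow> \<phi> \<alpha> p (v - w) = \<phi> \<alpha> p v - \<phi> \<alpha> p w"
  using phi_linear[of v p w \<alpha> 1 "- 1"] by simp

lemma xi_tangent: "\<xi> \<alpha> p \<in> T p"
  using vector_field_tangent[OF xi_field_UNIV] by blast

lemma xi_field: "open W \<Longrightarrow> vector_field_on A W (\<xi> \<alpha>)"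
  using vector_field_subset[OF xi_field_UNIV] by blast

lemma eta_smooth: "vector_field_on A W X \<Longrightarrow> smooth_fun_on A W (\<lambda>p. \<eta> \<alpha> p (X p))"
  using eta_form[of \<alpha>] unfolding one_form_def by blast

lemma eta_add: "v \<in> T p \<Longrightarrow> w \<in> T p \<Longrightarrow> \<eta> \<alpha> p (v + w) = \<eta> \<alpha> p v + \<eta> \<alpha> p w"
  and eta_diff: "v \<in> T p \<Longrightarrow> w \<in> T p \<Longrightarrow> \<eta> \<alpha> p (v - w) = \<eta> \<alpha> p v - \<eta> \<alpha> p w"
  and eta_neg: "v \<in> T p \<Longrightarrow> \<eta> \<alpha> p (- v) = - \<eta> \<alpha> p v"
  and eta_scale: "v \<in> T p \<Longrightarrow> \<eta> \<alpha> p (a *\<^sub>R v) = a * \<eta> \<alpha> p v"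
  and eta_zero: "\<eta> \<alpha> p 0 = 0"
  by (simp_all add: eta_g g_add_right g_diff_right g_neg_right g_scale_right g_zero_right xi_tangent
      tangent_add tangent_diff tangent_neg tangent_scale tangent_zero)

lemma eta_sum:
  assumes "\<And>i. i \<in> I \<Longrightarrow> v i \<in> T p"
  shows "\<eta> \<alpha> p (\<Sum>i\<in>I. v i) = (\<Sum>i\<in>I. \<eta> \<alpha> p (v i))"
  using assms
  by (induction I rule: infinite_finite_induct) (auto simp: eta_zero eta_add tangent_sum)

text \<open>The metric compatibility makes this vector have length zero.\<close>

lemma phi_xi: "\<phi> \<alpha> p (\<xi> \<alpha> p) = 0"
  using g_phi_phi[OF xi_tangent[of \<alpha>] xi_tangent[of \<alpha>], where \<alpha>=\<alpha>] eta_g[OF xi_tangent[of \<alpha> p], where \<alpha>=\<alpha>]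
    eta_xi_same[of \<alpha> p]
  by (intro g_definite[where p=p] phi_tangent xi_tangent) simp

text \<open>Computing the cube of \<open>\<phi> \<alpha>\<close> as \<open>\<phi> (\<phi>\<^sup>2 v)\<close> and as \<open>\<phi>\<^sup>2 (\<phi> v)\<close> leaves a difference
  \<open>\<eta> (\<phi> v) *\<^sub>R \<xi>\<close>, which must vanish.\<close>

lemma eta_phi_same:
  assumes v: "v \<in> T p"
  shows "\<eta> \<alpha> p (\<phi> \<alpha> p v) = 0"
proof -
  have "\<phi> \<alpha> p (\<phi> \<alpha> p (\<phi> \<alpha> p v)) = - \<phi> \<alpha> p v"
    by (simp add: phi_square[OF v] phi_diff phi_scale phi_xi v xi_tangent tangent_scale)
  then have "\<eta> \<alpha> p (\<phi> \<alpha> p v) *\<^sub>R \<xi> \<alpha> p = 0"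
    using phi_square[OF phi_tangent[OF v]] by simp
  then show ?thesis
    using eta_xi_same eta_zero by (metis scaleR_eq_0_iff zero_neq_one)
qed

lemma phi_skew:
  assumes v: "v \<in> T p" and w: "w \<in> T p"
  shows "g p (\<phi> \<alpha> p v) w = - g p v (\<phi> \<alpha> p w)"
proof -
  have "g p v (\<phi> \<alpha> p w) = g p (\<phi> \<alpha> p v) (\<phi> \<alpha> p (\<phi> \<alpha> p w))"
    by (simp add: g_phi_phi v phi_tangent w eta_phi_same)
  also have "\<dots> = - g p (\<phi> \<alpha> p v) w + \<eta> \<alpha> p w * \<eta> \<alpha> p (\<phi> \<alpha> p v)"
    by (simp add: phi_square[OF w] g_diff_right g_scale_right eta_g[OF phi_tangent[OF v]]
        v w phi_tangent xi_tangent tangent_scale g_sym[OF xi_tangent phi_tangent[OF v]])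
  finally show ?thesis
    by (simp add: eta_phi_same v)
qed

lemma quaternionic:
  assumes "(\<beta>, \<gamma>, \<theta>) \<in> {(1, 2, 3), (2, 3, 1), (3, 1, 2)}"
  shows "v \<in> T p \<Longrightarrow> \<eta> \<beta> p (\<phi> \<gamma> p v) = \<eta> \<theta> p v" "v \<in> T p \<Longrightarrow> \<eta> \<gamma> p (\<phi> \<beta> p v) = - \<eta> \<theta> p v"
    "\<phi> \<beta> p (\<xi> \<gamma> p) = \<xi> \<theta> p" "\<phi> \<gamma> p (\<xi> \<beta> p) = - \<xi> \<theta> p"
proof -
  have *: "(\<forall>v\<in>T p. \<eta> \<theta> p v = \<eta> \<beta> p (\<phi> \<gamma> p v) \<and> \<eta> \<theta> p v = - \<eta> \<gamma> p (\<phi> \<beta> p v)) \<and>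
      \<xi> \<theta> p = \<phi> \<beta> p (\<xi> \<gamma> p) \<and> \<xi> \<theta> p = - \<phi> \<gamma> p (\<xi> \<beta> p)"
    using three_sasakian assms unfolding three_sasakian_def by fast
  show "v \<in> T p \<Longrightarrow> \<eta> \<beta> p (\<phi> \<gamma> p v) = \<eta> \<theta> p v" "v \<in> T p \<Longrightarrow> \<eta> \<gamma> p (\<phi> \<beta> p v) = - \<eta> \<theta> p v"
    "\<phi> \<beta> p (\<xi> \<gamma> p) = \<xi> \<theta> p" "\<phi> \<gamma> p (\<xi> \<beta> p) = - \<xi> \<theta> p"
    using * by (metis minus_minus)+
qed

lemma cross_products:
  "\<phi> 1 p (\<xi> 2 p) = \<xi> 3 p" "\<phi> 2 p (\<xi> 3 p) = \<xi> 1 p" "\<phi> 3 p (\<xi> 1 p) = \<xi> 2 p"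
  "\<phi> 2 p (\<xi> 1 p) = - \<xi> 3 p" "\<phi> 3 p (\<xi> 2 p) = - \<xi> 1 p" "\<phi> 1 p (\<xi> 3 p) = - \<xi> 2 p"
  by (simp_all add: quaternionic(3,4))

lemma eta_phi:
  assumes "v \<in> T p"
  shows "\<eta> 1 p (\<phi> 2 p v) = \<eta> 3 p v" "\<eta> 2 p (\<phi> 3 p v) = \<eta> 1 p v" "\<eta> 3 p (\<phi> 1 p v) = \<eta> 2 p v"
    "\<eta> 2 p (\<phi> 1 p v) = - \<eta> 3 p v" "\<eta> 3 p (\<phi> 2 p v) = - \<eta> 1 p v" "\<eta> 1 p (\<phi> 3 p v) = - \<eta> 2 p v"
  using assms by (simp_all add: quaternionic(1,2))

text \<open>Each off-diagonal value is, up to sign and by one of the relations between the contact forms, the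
  value of a contact form at a vector \<open>\<phi> \<alpha> (\<xi> \<alpha>) = 0\<close>.\<close>

lemma eta_xi: "\<eta> \<alpha> p (\<xi> \<beta> p) = (if \<alpha> = \<beta> then 1 else 0)"
proof -
  have "\<eta> 3 p (\<xi> 2 p) = 0" "\<eta> 1 p (\<xi> 3 p) = 0" "\<eta> 2 p (\<xi> 1 p) = 0"
    "\<eta> 3 p (\<xi> 1 p) = 0" "\<eta> 1 p (\<xi> 2 p) = 0" "\<eta> 2 p (\<xi> 3 p) = 0"
    using eta_phi(1)[OF xi_tangent[of 2 p]] eta_phi(2)[OF xi_tangent[of 3 p]]
      eta_phi(3)[OF xi_tangent[of 1 p]] eta_phi(4)[OF xi_tangent[of 1 p]]
      eta_phi(5)[OF xi_tangent[of 2 p]] eta_phi(6)[OF xi_tangent[of 3 p]]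
    by (simp_all add: phi_xi eta_zero)
  then show ?thesis
    using exhaust_3[of \<alpha>] exhaust_3[of \<beta>] by (auto simp: eta_xi_same)
qed

lemma horizontal_phi:
  assumes "v \<in> T p" "\<And>\<alpha>. \<eta> \<alpha> p v = 0"
  shows "\<eta> \<alpha> p (\<phi> \<beta> p v) = 0"
  using exhaust_3[of \<alpha>] exhaust_3[of \<beta>] assms
  by (auto simp: eta_phi eta_phi_same)

text \<open>On the characteristic vectors the structure tensors act as the vector product of a
  three-dimensional Euclidean space, and the left-hand side is
  \<open>a \<times> b + (\<Sum>c. (a \<bullet> (c \<times> b)) c) = a \<times> b - a \<times> b\<close>.\<close>

lemma cross_product_vertical: "\<phi> \<alpha> p (\<xi> \<beta> p) + (\<Sum>\<gamma>\<in>UNIV. \<eta> \<alpha> p (\<phi> \<gamma> p (\<xi> \<beta> p)) *\<^sub>R \<xi> \<gamma> p) = 0"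
  using exhaust_3[of \<alpha>] exhaust_3[of \<beta>]
  by (auto simp: sum_3 cross_products phi_xi eta_xi eta_zero eta_neg xi_tangent)

section \<open>The Levi-Civita connection and the modified connection\<close>

lemma connection: "linear_connection_on A UNIV D"
  and torsion: "vector_field_on A W X \<Longrightarrow> vector_field_on A W Y \<Longrightarrow> p \<in> W \<Longrightarrow>
    D X Y p - D Y X p = lie_bracket A X Y p"
  and compatible: "vector_field_on A W X \<Longrightarrow> vector_field_on A W Y \<Longrightarrow> vector_field_on A W Z \<Longrightarrow> p \<in> W \<Longrightarrow>
    dapp (X p) (\<lambda>q. g q (Y q) (Z q)) = g p (D X Y p) (Z p) + g p (Y p) (D X Z p)"
  using levi_civita unfolding levi_civita_def by blast+

lemma nabla_field: "vector_field_on A W X \<Longrightarrow> vector_field_on A W Y \<Longrightarrow> vector_field_on A W (D X Y)"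
  using connection_field[OF connection] by blast

lemma nabla_tangent: "vector_field_on A W X \<Longrightarrow> vector_field_on A W Y \<Longrightarrow> p \<in> W \<Longrightarrow> D X Y p \<in> T p"
  using nabla_field vector_field_tangent by blast

text \<open>Differentiating \<open>\<phi> \<alpha> (\<xi> \<alpha>) = 0\<close> determines \<open>\<phi> \<alpha>\<close> of the derivative of \<open>\<xi> \<alpha>\<close>. Since \<open>\<xi> \<alpha>\<close>
  has constant length, this derivative is orthogonal to \<open>\<xi> \<alpha>\<close>, and on the
  orthogonal complement of \<open>\<xi> \<alpha>\<close> the tensor \<open>\<phi> \<alpha>\<close> is invertible.\<close>

lemma nabla_xi:
  assumes X: "vector_field_on A W X" and p: "p \<in> W"
  shows "D X (\<xi> \<alpha>) p = - \<phi> \<alpha> p (X p)"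
proof -
  note xi = xi_field[OF vector_field_open[OF X]]
  let ?v = "D X (\<xi> \<alpha>) p"
  have v: "?v \<in> T p" and x: "X p \<in> T p"
    using nabla_tangent[OF X xi p] vector_field_tangent[OF X p] .
  have "D X (\<lambda>q. \<phi> \<alpha> q (\<xi> \<alpha> q)) p = 0"
    using connection_zero_right[OF connection _ X p] by (simp add: phi_xi)
  then have "\<phi> \<alpha> p ?v = X p - \<eta> \<alpha> p (X p) *\<^sub>R \<xi> \<alpha> p"
    using nabla_phi[OF X xi[of \<alpha>] p, where \<alpha>=\<alpha>] eta_g[OF x] g_sym[OF x xi_tangent]
    by (simp add: eta_xi_same algebra_simps)
  then have "\<phi> \<alpha> p (\<phi> \<alpha> p ?v) = \<phi> \<alpha> p (X p)"
    by (simp add: phi_diff phi_scale x xi_tangent tangent_scale phi_xi)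
  moreover have "\<eta> \<alpha> p ?v = 0"
  proof -
    have "dapp (X p) (\<lambda>q. g q (\<xi> \<alpha> q) (\<xi> \<alpha> q)) = 0"
      by (rule dapp_const[OF x open_UNIV]) (simp_all add: eta_g[OF xi_tangent, symmetric] eta_xi)
    then show ?thesis
      using compatible[OF X xi[of \<alpha>] xi[of \<alpha>] p] g_sym[OF v xi_tangent] by (simp add: eta_g[OF v])
  qed
  ultimately have "- ?v = \<phi> \<alpha> p (X p)"
    using phi_square[OF v] by simp
  then show ?thesis
    by (metis minus_minus)
qed

abbreviation "bar \<equiv> bar_connection g D \<phi> \<xi> \<eta>"

lemma bar_via_phi:
  assumes X: "vector_field_on A W X" and Y: "vector_field_on A W Y" and p: "p \<in> W"
  shows "bar X Y p = D X Y p + (\<Sum>\<alpha>\<in>UNIV. \<eta> \<alpha> p (X p) *\<^sub>R \<phi> \<alpha> p (Y p))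
    + (\<Sum>\<alpha>\<in>UNIV. \<eta> \<alpha> p (Y p) *\<^sub>R \<phi> \<alpha> p (X p))
    + (\<Sum>\<alpha>\<in>UNIV. g p (X p) (\<phi> \<alpha> p (Y p)) *\<^sub>R \<xi> \<alpha> p)"
  by (simp add: bar_connection_def fundamental_form_def nabla_xi[OF X p] nabla_xi[OF Y p] sum_negf)

lemma bar_linear_connection: "linear_connection_on A UNIV bar"
  unfolding linear_connection_on_def
proof (intro conjI allI impI ballI; (elim conjE)?)
  fix W X Y assume X: "vector_field_on A W X" and Y: "vector_field_on A W Y"
  note W = vector_field_open[OF X]
  have "vector_field_on A W (\<lambda>p. D X Y p + (\<Sum>\<alpha>\<in>UNIV. \<eta> \<alpha> p (X p) *\<^sub>R \<phi> \<alpha> p (Y p))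
    + (\<Sum>\<alpha>\<in>UNIV. \<eta> \<alpha> p (Y p) *\<^sub>R \<phi> \<alpha> p (X p))
    + (\<Sum>\<alpha>\<in>UNIV. g p (X p) (\<phi> \<alpha> p (Y p)) *\<^sub>R \<xi> \<alpha> p))"
    by (intro vector_field_add vector_field_sum vector_field_scale nabla_field eta_smooth g_smooth
        phi_field xi_field X Y W)
  then show "vector_field_on A W (bar X Y)"
    by (rule vector_field_cong) (simp add: bar_via_phi[OF X Y])
  fix p assume p: "p \<in> W"
  have x: "X p \<in> T p" and y: "Y p \<in> T p"
    using vector_field_tangent[OF X p] vector_field_tangent[OF Y p] .
  {
    fix Z assume Z: "vector_field_on A W Z"
    have z: "Z p \<in> T p"
      using vector_field_tangent[OF Z p] .
    show "bar (\<lambda>q. X q + Z q) Y p = bar X Y p + bar Z Y p"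
      using connection_add_left[OF connection _ X Z Y p]
      by (simp add: bar_via_phi[OF X Y p] bar_via_phi[OF Z Y p] bar_via_phi[OF vector_field_add[OF X Z] Y p]
          eta_add phi_add g_add x y z phi_tangent scaleR_add_left scaleR_add_right sum.distrib)
    show "bar X (\<lambda>q. Y q + Z q) p = bar X Y p + bar X Z p"
      using connection_add_right[OF connection _ X Y Z p]
      by (simp add: bar_via_phi[OF X Y p] bar_via_phi[OF X Z p] bar_via_phi[OF X vector_field_add[OF Y Z] p]
          eta_add phi_add g_add_right x y z phi_tangent scaleR_add_left scaleR_add_right sum.distrib)
  }
  fix f assume f: "smooth_fun_on A W f"
  show "bar (\<lambda>q. f q *\<^sub>R X q) Y p = f p *\<^sub>R bar X Y p"
    using connection_scale_left[OF connection _ X Y f p]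
    by (simp add: bar_via_phi[OF X Y p] bar_via_phi[OF vector_field_scale[OF f X] Y p] eta_scale phi_scale g_scale
        x y phi_tangent scaleR_add_right scaleR_sum_right mult.commute)
  show "bar X (\<lambda>q. f q *\<^sub>R Y q) p = f p *\<^sub>R bar X Y p + dapp (X p) f *\<^sub>R Y p"
    using connection_scale_right[OF connection _ X Y f p]
    by (simp add: bar_via_phi[OF X Y p] bar_via_phi[OF X vector_field_scale[OF f Y] p] eta_scale phi_scale
        g_scale_right x y phi_tangent scaleR_add_right scaleR_sum_right mult.commute)
qed simp

lemma bar_xi_xi: "bar (\<xi> \<alpha>) (\<xi> \<beta>) p = 0"
proof -
  have "bar (\<xi> \<alpha>) (\<xi> \<beta>) p = \<phi> \<alpha> p (\<xi> \<beta> p) + (\<Sum>\<gamma>\<in>UNIV. \<eta> \<alpha> p (\<phi> \<gamma> p (\<xi> \<beta> p)) *\<^sub>R \<xi> \<gamma> p)"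
    by (simp add: bar_via_phi[OF xi_field_UNIV xi_field_UNIV] nabla_xi[OF xi_field_UNIV] eta_xi
        eta_g[OF phi_tangent[OF xi_tangent]] if_distrib[of "\<lambda>r. r *\<^sub>R _"] cong: if_cong)
  then show ?thesis
    by (simp add: cross_product_vertical)
qed

end

section \<open>The adapted frame\<close>

locale adapted_three_sasakian = three_sasakian_manifold A n g D \<phi> \<xi> \<eta>
  for A :: "('a::{t2_space, second_countable_topology}, 'm::finite) chart set"
    and n g D \<phi> \<xi> \<eta> +
  fixes U :: "'a set" and \<psi> :: "'a \<Rightarrow> real ^ 'm" and z :: "3 \<Rightarrow> 'm"
  assumes adapted: "adapted_chart A \<xi> (U, \<psi>) z"
begin

abbreviation "x j \<equiv> (\<lambda>q. \<psi> q $ j)"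
abbreviation "\<delta> \<equiv> delta A \<xi> \<eta> (U, \<psi>)"
abbreviation "I \<equiv> - range z"
abbreviation "coord \<equiv> coord_field A (U, \<psi>)"
abbreviation "V p \<equiv> span (range (\<lambda>\<alpha>. \<xi> \<alpha> p))"

lemma chart: "(U, \<psi>) \<in> A"
  and vertical_span: "p \<in> U \<Longrightarrow> V p = span (range (\<lambda>\<alpha>. coord (z \<alpha>) p))"
  using adapted unfolding adapted_chart_def by simp_all

lemma U_open: "open U"
  using chart chart_open by blast

lemma vertical_coordinate:
  assumes "p \<in> U" "j \<in> I" "v \<in> V p"
  shows "dapp v (x j) = 0"
proof -
  have "v \<in> span (range (\<lambda>\<alpha>. coord (z \<alpha>) p))"
    using assms vertical_span by blast
  then show ?thesis
  proof (induction rule: span_induct)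
    case base
    show ?case
      by (auto simp: subspace_def)
  next
    case (step v)
    then show ?case
      using assms(2) dapp_coord_field[OF chart assms(1)] by auto
  qed
qed

lemma xi_vertical: "\<xi> \<alpha> p \<in> V p"
  by (simp add: span_base)

lemma verticalI:
  assumes "p \<in> U" "v \<in> T p" "\<And>j. j \<in> I \<Longrightarrow> dapp v (x j) = 0"
  shows "v \<in> V p"
proof -
  have "dapp v (x m) *\<^sub>R coord m p \<in> span (range (\<lambda>\<alpha>. coord (z \<alpha>) p))" for m
  proof (cases "m \<in> I")
    case True
    then show ?thesis by (simp add: assms(3) span_zero)
  next
    case False
    then show ?thesis by (auto intro: span_scale span_base)
  qed
  then have "(\<Sum>m\<in>UNIV. dapp v (x m) *\<^sub>R coord m p) \<in> V p"
    unfolding vertical_span[OF assms(1)] by (intro span_sum)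
  then show ?thesis
    unfolding tangent_expansion[OF chart assms(1,2), symmetric] .
qed

text \<open>Tangency of \<open>w\<close> is part of the conclusion because the metric is only linear on tangent vectors,
  so the induction over the span has to carry it along.\<close>

lemma horizontal_orthogonal_vertical:
  assumes "v \<in> T p" "\<And>\<alpha>. \<eta> \<alpha> p v = 0" "w \<in> V p"
  shows "w \<in> T p \<and> g p w v = 0"
  using assms(3)
proof (induction rule: span_induct)
  case base
  show ?case
    using assms(1) by (auto simp: subspace_def tangent_zero tangent_add tangent_scale g_zero g_add g_scale)
next
  case (step w)
  then show ?case
    using assms(1,2) xi_tangent by (auto simp: eta_g)
qed

lemma vertical_horizontal_zero:
  assumes "v \<in> V p" "v \<in> T p" "\<And>\<alpha>. \<eta> \<alpha> p v = 0"
  shows "v = 0"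
  using horizontal_orthogonal_vertical[OF assms(2,3,1)] g_definite by blast

lemma coord_tangent: "p \<in> U \<Longrightarrow> coord i p \<in> T p"
  using vector_field_tangent[OF coord_vector_field[OF chart]] .

lemma delta_field: "vector_field_on A U (\<delta> i)"
  unfolding delta_def
  by (intro vector_field_diff vector_field_sum vector_field_scale eta_smooth coord_vector_field chart
      xi_field U_open)

lemma delta_tangent: "p \<in> U \<Longrightarrow> \<delta> i p \<in> T p"
  using vector_field_tangent[OF delta_field] .

lemma delta_horizontal: "p \<in> U \<Longrightarrow> \<eta> \<alpha> p (\<delta> i p) = 0"
  by (simp add: delta_def eta_diff eta_sum eta_scale eta_xi coord_tangent xi_tangent tangent_scale
      tangent_sum if_distrib cong: if_cong)

lemma delta_coordinate:
  assumes "p \<in> U" "j \<in> I"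
  shows "dapp (\<delta> i p) (x j) = (if i = j then 1 else 0)"
  using vertical_coordinate[OF assms xi_vertical] dapp_coord_field[OF chart assms(1)]
  by (simp add: delta_def dapp_sum)

text \<open>The difference of the two sides is annihilated by the transversal coordinates, so it is
  vertical, and by the three contact forms, so it is horizontal.\<close>

lemma frame_expansion:
  assumes "p \<in> U" "v \<in> T p"
  shows "v = (\<Sum>\<alpha>\<in>UNIV. \<eta> \<alpha> p v *\<^sub>R \<xi> \<alpha> p) + (\<Sum>i\<in>I. dapp v (x i) *\<^sub>R \<delta> i p)"
proof -
  let ?a = "\<Sum>\<alpha>\<in>UNIV. \<eta> \<alpha> p v *\<^sub>R \<xi> \<alpha> p" and ?b = "\<Sum>i\<in>I. dapp v (x i) *\<^sub>R \<delta> i p"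
  have t: "?a \<in> T p" "?b \<in> T p"
    by (auto intro!: tangent_sum tangent_scale xi_tangent delta_tangent assms)
  have "\<eta> \<alpha> p (v - (?a + ?b)) = 0" for \<alpha>
    by (simp add: eta_diff eta_add eta_sum eta_scale eta_xi delta_horizontal assms t xi_tangent
        delta_tangent tangent_scale tangent_add if_distrib cong: if_cong)
  moreover have "dapp (v - (?a + ?b)) (x j) = 0" if "j \<in> I" for j
    using vertical_coordinate[OF assms(1) that xi_vertical] that
    by (simp add: dapp_sum delta_coordinate assms(1) if_distrib cong: if_cong)
  moreover have "v - (?a + ?b) \<in> T p"
    using t assms(2) by (intro tangent_diff tangent_add)
  ultimately have "v - (?a + ?b) = 0"
    using vertical_horizontal_zero verticalI assms(1) by blast
  then show ?thesis
    by simp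
qed

text \<open>The torsion-free connection turns the left-hand side into the bracket. Applied to a transversal
  coordinate, the bracket differentiates functions that are constant on the chart domain.\<close>

lemma torsion_vertical:
  assumes X: "vector_field_on A U X" "\<And>q j. q \<in> U \<Longrightarrow> j \<in> I \<Longrightarrow> dapp (X q) (x j) = a j"
    and Y: "vector_field_on A U Y" "\<And>q j. q \<in> U \<Longrightarrow> j \<in> I \<Longrightarrow> dapp (Y q) (x j) = b j"
    and p: "p \<in> U"
  shows "D X Y p - D Y X p \<in> V p"
proof (rule verticalI[OF p])
  show "D X Y p - D Y X p \<in> T p"
    using nabla_tangent X(1) Y(1) p tangent_diff by metis
  fix j assume j: "j \<in> I"
  have "dapp (lie_bracket A X Y p) (x j) =
      dapp (X p) (\<lambda>q. dapp (Y q) (x j)) - dapp (Y p) (\<lambda>q. dapp (X q) (x j))"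
    using smooth_fun_on_near[OF coordinate_smooth[OF chart] p]
    by (simp add: lie_bracket_def Tvec_inverse)
  moreover have "dapp (X p) (\<lambda>q. dapp (Y q) (x j)) = 0"
    by (rule dapp_const[OF vector_field_tangent[OF X(1) p] U_open p]) (rule Y(2)[OF _ j])
  moreover have "dapp (Y p) (\<lambda>q. dapp (X q) (x j)) = 0"
    by (rule dapp_const[OF vector_field_tangent[OF Y(1) p] U_open p]) (rule X(2)[OF _ j])
  ultimately show "dapp (D X Y p - D Y X p) (x j) = 0"
    by (simp only: torsion[OF X(1) Y(1) p])
qed

lemma g_delta_xi:
  assumes p: "p \<in> U"
  shows "g p (\<delta> i p) (\<xi> \<alpha> p) = 0"
  unfolding g_sym[OF delta_tangent[OF p] xi_tangent] eta_g[OF delta_tangent[OF p], symmetric]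
  by (rule delta_horizontal[OF p])

lemma g_delta_phi_xi:
  assumes p: "p \<in> U"
  shows "g p (\<delta> i p) (\<phi> \<beta> p (\<xi> \<alpha> p)) = 0"
proof -
  note d = delta_tangent[OF p]
  have "g p (\<xi> \<alpha> p) (\<phi> \<beta> p (\<delta> i p)) = 0"
    unfolding eta_g[OF phi_tangent[OF d], symmetric]
    by (rule horizontal_phi[OF d delta_horizontal[OF p]])
  then show ?thesis
    unfolding g_sym[OF phi_tangent[OF d] xi_tangent, symmetric] phi_skew[OF d xi_tangent] by simp
qed

text \<open>Differentiating the orthogonality of \<open>\<delta> i\<close> and \<open>\<xi> \<alpha>\<close> moves the derivative to \<open>\<xi> \<alpha>\<close>, where it is
  known.\<close>

lemma nabla_delta_xi_component:
  assumes X: "vector_field_on A U X" and p: "p \<in> U"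
  shows "\<eta> \<alpha> p (D X (\<delta> i) p) = g p (\<delta> i p) (\<phi> \<alpha> p (X p))"
proof -
  note xi = xi_field[OF U_open] and x = vector_field_tangent[OF X p]
  have "dapp (X p) (\<lambda>q. g q (\<delta> i q) (\<xi> \<alpha> q)) = 0"
    by (rule dapp_const[OF x U_open p]) (rule g_delta_xi)
  then have "g p (D X (\<delta> i) p) (\<xi> \<alpha> p) = - g p (\<delta> i p) (D X (\<xi> \<alpha>) p)"
    using compatible[OF X delta_field xi p] by simp
  then show ?thesis
    using nabla_tangent[OF X delta_field p] x
    by (simp add: eta_g g_sym[OF _ xi_tangent] nabla_xi[OF X p] g_neg_right phi_tangent delta_tangent p)
qed

lemma bar_delta_xi:
  assumes "p \<in> U"
  shows "bar (\<delta> i) (\<xi> \<alpha>) p = 0"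
  by (simp add: bar_via_phi[OF delta_field xi_field[OF U_open] assms] nabla_xi[OF delta_field assms] assms
      delta_horizontal g_delta_phi_xi eta_xi if_distrib[of "\<lambda>r. r *\<^sub>R _"] cong: if_cong)

text \<open>What remains of the definition is the torsion term \<open>D (\<xi> \<alpha>) (\<delta> i) - D (\<delta> i) (\<xi> \<alpha>)\<close>. It is
  the bracket of the two fields, and it is both vertical and horizontal.\<close>

lemma bar_xi_delta:
  assumes p: "p \<in> U"
  shows "bar (\<xi> \<alpha>) (\<delta> i) p = 0"
proof -
  note xi = xi_field[OF U_open] and d = delta_tangent[OF p]
  let ?u = "D (\<xi> \<alpha>) (\<delta> i) p - D (\<delta> i) (\<xi> \<alpha>) p"
  have u: "?u \<in> T p"
    by (intro tangent_diff nabla_tangent[OF xi delta_field p] nabla_tangent[OF delta_field xi p])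
  have eta0: "\<eta> \<beta> p (\<phi> \<gamma> p (\<delta> i p)) = 0" for \<beta> \<gamma>
    using horizontal_phi[OF d delta_horizontal[OF p]] .
  have "?u \<in> V p"
    by (rule torsion_vertical[where a="\<lambda>j. 0" and b="\<lambda>j. if i = j then 1 else 0"])
      (use xi delta_field p vertical_coordinate xi_vertical delta_coordinate in auto)
  moreover have "\<eta> \<beta> p ?u = 0" for \<beta>
    by (simp add: eta_add nabla_tangent[OF xi delta_field p] nabla_delta_xi_component[OF xi p]
        g_delta_phi_xi p nabla_xi[OF delta_field p] phi_tangent d eta0)
  ultimately have "?u = 0"
    using vertical_horizontal_zero u by blast
  moreover have "g p (\<xi> \<alpha> p) (\<phi> \<beta> p (\<delta> i p)) = 0" for \<beta>
    using eta0 eta_g[OF phi_tangent[OF d]] by simp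
  ultimately show ?thesis
    by (simp add: bar_via_phi[OF xi delta_field p] nabla_xi[OF delta_field p] delta_horizontal p eta_xi
        if_distrib[of "\<lambda>r. r *\<^sub>R _"] cong: if_cong)
qed

abbreviation "G \<equiv> transversal_metric A g \<xi> \<eta> (U, \<psi>)"

text \<open>With \<open>a i j h = g (D (\<delta> i) (\<delta> j)) (\<delta> h)\<close>, metric compatibility gives
  \<open>\<delta> i (G j h) = a i j h + a i h j\<close>. The torsion is vertical, so \<open>a\<close> is symmetric in the first two
  indices, and the alternating sum collapses.\<close>

lemma koszul:
  assumes p: "p \<in> U"
  shows "2 * g p (D (\<delta> i) (\<delta> j) p) (\<delta> h p) =
    dapp (\<delta> j p) (G i h) + dapp (\<delta> i p) (G j h) - dapp (\<delta> h p) (G i j)"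
proof -
  define a where "a i j h = g p (D (\<delta> i) (\<delta> j) p) (\<delta> h p)" for i j h
  note nt = nabla_tangent[OF delta_field delta_field p] and d = delta_tangent[OF p]
  have G: "dapp (\<delta> i p) (G j h) = a i j h + a i h j" for i j h
    using compatible[OF delta_field[of i] delta_field[of j] delta_field[of h] p] g_sym[OF d nt]
    by (simp add: transversal_metric_def[abs_def] a_def)
  have sym: "a i j h = a j i h" for i j h
  proof -
    have "D (\<delta> i) (\<delta> j) p - D (\<delta> j) (\<delta> i) p \<in> V p"
      by (rule torsion_vertical[OF delta_field delta_coordinate delta_field delta_coordinate p])
    from horizontal_orthogonal_vertical[OF d delta_horizontal[OF p] this]
    show ?thesis
      by (simp add: a_def g_diff nt d)
  qed
  show ?thesis
    using sym[of i j h] sym[of i h j] sym[of j h i]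
    by (simp add: G a_def[symmetric])
qed

text \<open>A vector in the kernel of the Gram matrix gives a combination of the \<open>\<delta> k\<close> of length zero; the
  transversal coordinates read off its coefficients.\<close>

lemma transversal_inverse:
  assumes p: "p \<in> U" and "k \<in> I" "l \<in> I"
  shows "(\<Sum>h\<in>I. inverse_matrix_on I (\<lambda>a b. G a b p) k h * G h l p) = (if k = l then 1 else 0)"
proof (rule inverse_matrix_on_left[OF _ assms(2,3)])
  fix y i assume y: "\<And>i. i \<in> I \<Longrightarrow> (\<Sum>k\<in>I. G i k p * y k) = 0" and i: "i \<in> I"
  note d = delta_tangent[OF p]
  let ?u = "\<Sum>k\<in>I. y k *\<^sub>R \<delta> k p"
  have u: "?u \<in> T p"
    by (intro tangent_sum tangent_scale d)
  have ud: "g p ?u (\<delta> i p) = 0" if "i \<in> I" for i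
  proof -
    have "g p ?u (\<delta> i p) = (\<Sum>k\<in>I. G i k p * y k)"
      by (simp add: g_sum g_scale tangent_scale d transversal_metric_def g_sym[OF d d[of i]] mult.commute)
    then show ?thesis
      using y[OF that] by simp
  qed
  have "g p ?u ?u = (\<Sum>k\<in>I. y k * g p (\<delta> k p) ?u)"
    by (subst g_sum) (simp_all add: tangent_scale d u g_scale)
  also have "\<dots> = 0"
    by (intro sum.neutral ballI) (simp add: ud g_sym[OF d u])
  finally have "?u = 0"
    using g_definite[OF u] by blast
  then have "dapp ?u (x i) = 0"
    by simp
  then show "y i = 0"
    using i by (simp add: dapp_sum delta_coordinate p if_distrib cong: if_cong)
qed

text \<open>The vertical part of the Levi-Civita derivative cancels against the fundamental forms. The
  horizontal rest is a combination of the \<open>\<delta> k\<close>, whose coefficients come from its inner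
  products with the \<open>\<delta> h\<close> by inverting the Gram matrix.\<close>

lemma bar_delta_delta:
  assumes p: "p \<in> U"
  shows "bar (\<delta> i) (\<delta> j) p = (\<Sum>k\<in>I. transversal_coeff A g \<xi> \<eta> (U, \<psi>) z k i j p *\<^sub>R \<delta> k p)"
proof -
  note d = delta_tangent[OF p] and nt = nabla_tangent[OF delta_field delta_field p]
  let ?w = "bar (\<delta> i) (\<delta> j) p"
  let ?B = "inverse_matrix_on I (\<lambda>a b. G a b p)"
  let ?s = "\<Sum>\<alpha>\<in>UNIV. g p (\<delta> i p) (\<phi> \<alpha> p (\<delta> j p)) *\<^sub>R \<xi> \<alpha> p"
  have s: "?s \<in> T p"
    by (intro tangent_sum tangent_scale xi_tangent)
  have weq: "?w = D (\<delta> i) (\<delta> j) p + ?s"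
    by (simp add: bar_via_phi[OF delta_field delta_field p] delta_horizontal p)
  have w: "?w \<in> T p"
    unfolding weq by (intro tangent_add nt s)
  have "\<eta> \<alpha> p ?w = 0" for \<alpha>
    unfolding weq using phi_skew[OF d[of i] d[of j], where \<alpha>=\<alpha>]
      g_sym[OF phi_tangent[OF d[of i], where \<alpha>=\<alpha>] d[of j]]
    by (simp add: eta_add nt s eta_sum eta_scale eta_xi xi_tangent tangent_scale
        nabla_delta_xi_component[OF delta_field p] if_distrib cong: if_cong)
  then have expand: "?w = (\<Sum>k\<in>I. dapp ?w (x k) *\<^sub>R \<delta> k p)"
    using frame_expansion[OF p w] by simp
  have "g p ?s (\<delta> h p) = 0" for h
    by (simp add: g_sum g_scale xi_tangent tangent_scale d g_sym[OF xi_tangent d] g_delta_xi p)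
  then have gw: "g p ?w (\<delta> h p) = g p (D (\<delta> i) (\<delta> j) p) (\<delta> h p)" for h
    by (simp add: weq g_add nt s d)
  have gw': "g p ?w (\<delta> h p) = (\<Sum>l\<in>I. dapp ?w (x l) * G h l p)" for h
    by (subst expand) (simp add: g_sum g_scale tangent_scale d transversal_metric_def g_sym[OF d d[of h]])
  have "transversal_coeff A g \<xi> \<eta> (U, \<psi>) z k i j p = dapp ?w (x k)" if k: "k \<in> I" for k
  proof -
    have "transversal_coeff A g \<xi> \<eta> (U, \<psi>) z k i j p = (\<Sum>h\<in>I. ?B k h / 2 * (2 * g p ?w (\<delta> h p)))"
      by (simp only: transversal_coeff_def Let_def gw koszul[OF p])
    also have "\<dots> = (\<Sum>h\<in>I. \<Sum>l\<in>I. dapp ?w (x l) * (?B k h * G h l p))"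
      by (simp add: gw' sum_distrib_left mult_ac)
    also have "\<dots> = (\<Sum>l\<in>I. dapp ?w (x l) * (\<Sum>h\<in>I. ?B k h * G h l p))"
      by (subst sum.swap) (simp add: sum_distrib_left)
    also have "\<dots> = dapp ?w (x k)"
      using k by (simp add: transversal_inverse[OF p k] if_distrib cong: if_cong)
    finally show ?thesis .
  qed
  then show ?thesis
    by (subst expand) simp
qed

lemma bar_adapted_equations: "adapted_equations A g \<xi> \<eta> (U, \<psi>) z bar"
  unfolding adapted_equations_def Let_def
  by (auto simp: bar_delta_delta bar_delta_xi bar_xi_delta bar_xi_xi)

fun frame :: "3 + 'm \<Rightarrow> 'a \<Rightarrow> 'a tvec" where
  "frame (Inl \<alpha>) = \<xi> \<alpha>"
| "frame (Inr i) = \<delta> i"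

fun component :: "('a \<Rightarrow> 'a tvec) \<Rightarrow> 3 + 'm \<Rightarrow> 'a \<Rightarrow> real" where
  "component X (Inl \<alpha>) = (\<lambda>q. \<eta> \<alpha> q (X q))"
| "component X (Inr i) = (\<lambda>q. dapp (X q) (x i))"

text \<open>The transversal components are derivatives of coordinate functions along the field, and the
  vertical ones are values of the contact forms; this is why they are smooth.\<close>

lemma frame_components:
  assumes X: "vector_field_on A W X" and W: "W \<subseteq> U"
  shows "s \<in> UNIV <+> I \<Longrightarrow> smooth_fun_on A W (component X s)"
    and "q \<in> W \<Longrightarrow> X q = (\<Sum>s\<in>UNIV <+> I. component X s q *\<^sub>R frame s q)"
proof -
  have "smooth_fun_on A W (\<lambda>q. dapp (X q) (x i))" for i
    using vector_field_smooth[OF X order_refl]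
      smooth_fun_on_subset[OF coordinate_smooth[OF chart] W vector_field_open[OF X]] by blast
  then show "smooth_fun_on A W (component X s)"
    using eta_smooth[OF X] by (cases s) simp_all
  show "X q = (\<Sum>s\<in>UNIV <+> I. component X s q *\<^sub>R frame s q)" if "q \<in> W"
    using frame_expansion[OF _ vector_field_tangent[OF X that]] that W
    by (simp add: sum.Plus subset_iff)
qed

lemma adapted_equations_determine:
  assumes E: "linear_connection_on A U E" "adapted_equations A g \<xi> \<eta> (U, \<psi>) z E"
    and W: "W \<subseteq> U" and X: "vector_field_on A W X" and Y: "vector_field_on A W Y" and p: "p \<in> W"
  shows "E X Y p = bar X Y p"
proof (rule connection_determined_by_frame[OF E(1) bar_linear_connection W subset_UNIV X Y p])
  show "vector_field_on A W (frame s)" for s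
    using xi_field vector_field_subset[OF delta_field W] vector_field_open[OF X] by (cases s) simp_all
  show "smooth_fun_on A W (component X s)" if "s \<in> UNIV <+> I" for s
    using frame_components(1)[OF X W that] .
  show "smooth_fun_on A W (component Y s)" if "s \<in> UNIV <+> I" for s
    using frame_components(1)[OF Y W that] .
  show "X q = (\<Sum>s\<in>UNIV <+> I. component X s q *\<^sub>R frame s q)" if "q \<in> W" for q
    using frame_components(2)[OF X W that] .
  show "Y q = (\<Sum>s\<in>UNIV <+> I. component Y s q *\<^sub>R frame s q)" if "q \<in> W" for q
    using frame_components(2)[OF Y W that] .
  show "E (frame s) (frame t) p = bar (frame s) (frame t) p" if "s \<in> UNIV <+> I" "t \<in> UNIV <+> I" for s t
  proof -
    have pU: "p \<in> U" using W p by blast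
    note eqs = E(2)[unfolded adapted_equations_def Let_def fst_conv, THEN bspec, OF pU]
    show ?thesis
      using that eqs bar_delta_delta[OF pU] bar_delta_xi[OF pU] bar_xi_delta[OF pU] bar_xi_xi
      by (cases s; cases t) auto
  qed
qed

end

theorem theorem3:
  fixes A :: "('a::{t2_space, second_countable_topology}, 'm::finite) chart set"
    and g :: "'a \<Rightarrow> 'a tvec \<Rightarrow> 'a tvec \<Rightarrow> real"
    and D :: "('a \<Rightarrow> 'a tvec) \<Rightarrow> ('a \<Rightarrow> 'a tvec) \<Rightarrow> 'a \<Rightarrow> 'a tvec"
    and \<phi> :: "3 \<Rightarrow> 'a \<Rightarrow> 'a tvec \<Rightarrow> 'a tvec"
    and \<xi> :: "3 \<Rightarrow> 'a \<Rightarrow> 'a tvec"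
    and \<eta> :: "3 \<Rightarrow> 'a \<Rightarrow> 'a tvec \<Rightarrow> real"
    and c :: "('a, 'm) chart" and z :: "3 \<Rightarrow> 'm" and n :: nat
  assumes "three_sasakian n A g D \<phi> \<xi> \<eta>"
    and "adapted_chart A \<xi> c z"
  shows "linear_connection_on A UNIV (bar_connection g D \<phi> \<xi> \<eta>) \<and>
    adapted_equations A g \<xi> \<eta> c z (bar_connection g D \<phi> \<xi> \<eta>) \<and>
    (\<forall>E. linear_connection_on A (fst c) E \<and> adapted_equations A g \<xi> \<eta> c z E \<longrightarrow>
       (\<forall>W X Y. W \<subseteq> fst c \<and> vector_field_on A W X \<and> vector_field_on A W Y \<longrightarrow>
          (\<forall>p\<in>W. E X Y p = bar_connection g D \<phi> \<xi> \<eta> X Y p)))"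
proof -
  obtain U \<psi> where c: "c = (U, \<psi>)"
    by (cases c)
  have "smooth_manifold A"
    using assms(1) unfolding three_sasakian_def by (rule conjunct1)
  moreover have "adapted_chart A \<xi> (U, \<psi>) z"
    using assms(2) unfolding c .
  ultimately interpret adapted_three_sasakian A n g D \<phi> \<xi> \<eta> U \<psi> z
    using assms(1) by unfold_locales
  show ?thesis
    unfolding c fst_conv
    by (intro conjI allI impI ballI bar_linear_connection bar_adapted_equations; elim conjE;
        rule adapted_equations_determine)
qed

end
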